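(* With $Y_k$ and $Z_k$ as defined in the context, the matrices $I-Y_kZ_k$ and $I-Z_kY_k$ are nonsingular M-matrices for all $k\ge 0$.
   Context: Inequalities between matrices are entrywise. An M-matrix is a real square matrix of the form $sI-N$ with $N\ge 0$ and $s\ge\rho(N)$ (spectral radius); it is nonsingular iff $s>\rho(N)$ for such a representation. Standing assumptions: $A\in\mathbb R^{m\times m}$, $D\in\mathbb R^{n\times n}$, $B\in\mathbb R^{m\times n}$, $C\in\mathbb R^{n\times m}$ are such that $W=\begin{bmatrix}D&-C\\-B&A\end{bmatrix}$ is a nonsingular M-matrix or an irreducible singular M-matrix. There are full rank factorizations $B=B_lB_r^{\mathsf T}$, $C=C_lC_r^{\mathsf T}$ with $0\le B_l\in\mathbb R^{m\times p}$, $0\le B_r\in\mathbb R^{n\times p}$, $0\le C_l\in\mathbb R^{n\times q}$, $0\le C_r\in\mathbb R^{m\times q}$ (all of full column rank). The parameters satisfy $0\le\alpha\le\min_i a_{ii}^{-1}$, $0\le\beta\le\min_j d_{jj}^{-1}$, $\max\{\alpha,\beta\}>0$, where $a_{ii},d_{jj}$ are the diagonal entries of $A$ and $D$. Put $\gamma=\alpha+\beta$. For a real number $t$ write $A_t:=tA+I_m$ and $D_t:=tD+I_n$. Define $A_{\alpha,\beta}=A_\beta^{-1}A_{-\alpha}$, $D_{\alpha,\beta}=D_\alpha^{-1}D_{-\beta}$, $$U_0=A_\beta^{-1}B_l,\quad V_0=A_\beta^{-\mathsf T}C_r,\quad W_0=D_\alpha^{-1}C_l,\quad Q_0=D_\alpha^{-\mathsf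 T}B_r,$$ $$Y_0=\alpha B_r^{\mathsf T}D_\alpha^{-1}C_l\in\mathbb R^{p\times q},\quad Z_0=\beta C_r^{\mathsf T}A_\beta^{-1}B_l\in\mathbb R^{q\times p},$$ and for $j\ge 1$: $U_j=A_{\alpha,\beta}U_{j-1}$, $V_j=A_{\alpha,\beta}^{\mathsf T}V_{j-1}$, $W_j=D_{\alpha,\beta}W_{j-1}$, $Q_j=D_{\alpha,\beta}^{\mathsf T}Q_{j-1}$. For $k\ge 0$ let $\check U_k=[U_0,\dots,U_{2^k-1}]$, $\check V_k=[V_0,\dots,V_{2^k-1}]$, $\check W_k=[W_0,\dots,W_{2^k-1}]$, $\check Q_k=[Q_0,\dots,Q_{2^k-1}]$, $T_k=\check Q_k^{\mathsf T}\check W_k$, $S_k=\check V_k^{\mathsf T}\check U_k$, and for $k\ge 1$ $$Y_k=\begin{bmatrix}0&Y_{k-1}\\ Y_{k-1}&\gamma T_{k-1}\end{bmatrix},\qquad Z_k=\begin{bmatrix}0&Z_{k-1}\\ Z_{k-1}&\gamma S_{k-1}\end{bmatrix}.$$ *)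

theory Defs
  imports
    "Jordan_Normal_Form.Spectral_Radius"
    "Jordan_Normal_Form.Gauss_Jordan_Elimination"
    "Jordan_Normal_Form.DL_Rank"
begin

(* The library's spectral_radius is the maximum of the moduli of the eigenvalues, which is
   unspecified for the matrix of size 0 (no eigenvalues); there the value is taken to be 0. *)
definition rho :: "real mat \<Rightarrow> real" where
  "rho N = (if dim_row N = 0 then 0 else spectral_radius (map_mat complex_of_real N))"

(* The order on matrices is the library's entrywise order (which includes equality of the
   dimensions). *)
definition M_matrix :: "real mat \<Rightarrow> bool" where
  "M_matrix M \<longleftrightarrow> square_mat M \<and>
     (\<exists>s N. N \<in> carrier_mat (dim_row M) (dim_row M) \<and>
        0\<^sub>m (dim_row M) (dim_row M) \<le> N \<and> rho N \<le> s \<and>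
        M = s \<cdot>\<^sub>m 1\<^sub>m (dim_row M) - N)"

definition nonsingular_M_matrix :: "real mat \<Rightarrow> bool" where
  "nonsingular_M_matrix M \<longleftrightarrow> M_matrix M \<and> invertible_mat M"

definition singular_M_matrix :: "real mat \<Rightarrow> bool" where
  "singular_M_matrix M \<longleftrightarrow> M_matrix M \<and> \<not> invertible_mat M"

(* Reducible: a simultaneous permutation of rows and columns yields a block triangular form with
   square diagonal blocks of positive size; J is the index set of one of the diagonal blocks. *)
definition reducible_mat :: "real mat \<Rightarrow> bool" where
  "reducible_mat M \<longleftrightarrow>
     (\<exists>J. J \<noteq> {} \<and> J \<subset> {..<dim_row M} \<and>
        (\<forall>i\<in>J. \<forall>j\<in>{..<dim_row M} - J. M $$ (i, j) = 0))"

definition irreducible_mat :: "real mat \<Rightarrow> bool" where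
  "irreducible_mat M \<longleftrightarrow> square_mat M \<and> \<not> reducible_mat M"

definition full_column_rank :: "real mat \<Rightarrow> bool" where
  "full_column_rank M \<longleftrightarrow> vec_space.rank (dim_row M) M = dim_col M"

(* Unspecified if M is not invertible. *)
definition inv_mat :: "real mat \<Rightarrow> real mat" where
  "inv_mat M = the (mat_inverse M)"

definition shift_mat :: "real mat \<Rightarrow> real \<Rightarrow> real mat" where
  "shift_mat M t = t \<cdot>\<^sub>m M + 1\<^sub>m (dim_row M)"

(* A_{alpha,beta} = trans_mat A alpha beta, whereas D_{alpha,beta} = trans_mat D beta alpha:
   the two parameters swap roles. *)
definition trans_mat :: "real mat \<Rightarrow> real \<Rightarrow> real \<Rightarrow> real mat" where
  "trans_mat M a b = inv_mat (shift_mat M b) * shift_mat M (- a)"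

fun iter_mat :: "real mat \<Rightarrow> real mat \<Rightarrow> nat \<Rightarrow> real mat" where
  "iter_mat M X 0 = X"
| "iter_mat M X (Suc j) = M * iter_mat M X j"

definition U_seq :: "real \<Rightarrow> real \<Rightarrow> real mat \<Rightarrow> real mat \<Rightarrow> nat \<Rightarrow> real mat" where
  "U_seq \<alpha> \<beta> A Bl = iter_mat (trans_mat A \<alpha> \<beta>) (inv_mat (shift_mat A \<beta>) * Bl)"

definition V_seq :: "real \<Rightarrow> real \<Rightarrow> real mat \<Rightarrow> real mat \<Rightarrow> nat \<Rightarrow> real mat" where
  "V_seq \<alpha> \<beta> A Cr =
     iter_mat (transpose_mat (trans_mat A \<alpha> \<beta>)) (transpose_mat (inv_mat (shift_mat A \<beta>)) * Cr)"

definition W_seq :: "real \<Rightarrow> real \<Rightarrow> real mat \<Rightarrow> real mat \<Rightarrow> nat \<Rightarrow> real mat" where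
  "W_seq \<alpha> \<beta> D Cl = iter_mat (trans_mat D \<beta> \<alpha>) (inv_mat (shift_mat D \<alpha>) * Cl)"

definition Q_seq :: "real \<Rightarrow> real \<Rightarrow> real mat \<Rightarrow> real mat \<Rightarrow> nat \<Rightarrow> real mat" where
  "Q_seq \<alpha> \<beta> D Br =
     iter_mat (transpose_mat (trans_mat D \<beta> \<alpha>)) (transpose_mat (inv_mat (shift_mat D \<alpha>)) * Br)"

(* The block row [X 0, ..., X (N - 1)], for blocks X j of the same dimensions. *)
definition block_row :: "(nat \<Rightarrow> real mat) \<Rightarrow> nat \<Rightarrow> real mat" where
  "block_row X N = mat (dim_row (X 0)) (N * dim_col (X 0))
     (\<lambda>(i, c). X (c div dim_col (X 0)) $$ (i, c mod dim_col (X 0)))"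

definition T_mat ::
  "real \<Rightarrow> real \<Rightarrow> real mat \<Rightarrow> real mat \<Rightarrow> real mat \<Rightarrow> nat \<Rightarrow> real mat" where
  "T_mat \<alpha> \<beta> D Br Cl k =
     transpose_mat (block_row (Q_seq \<alpha> \<beta> D Br) (2 ^ k)) * block_row (W_seq \<alpha> \<beta> D Cl) (2 ^ k)"

definition S_mat ::
  "real \<Rightarrow> real \<Rightarrow> real mat \<Rightarrow> real mat \<Rightarrow> real mat \<Rightarrow> nat \<Rightarrow> real mat" where
  "S_mat \<alpha> \<beta> A Bl Cr k =
     transpose_mat (block_row (V_seq \<alpha> \<beta> A Cr) (2 ^ k)) * block_row (U_seq \<alpha> \<beta> A Bl) (2 ^ k)"

fun Y_mat ::
  "real \<Rightarrow> real \<Rightarrow> real mat \<Rightarrow> real mat \<Rightarrow> real mat \<Rightarrow> nat \<Rightarrow> real mat" where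
  "Y_mat \<alpha> \<beta> D Br Cl 0 = \<alpha> \<cdot>\<^sub>m (transpose_mat Br * inv_mat (shift_mat D \<alpha>) * Cl)"
| "Y_mat \<alpha> \<beta> D Br Cl (Suc k) =
     (let Y = Y_mat \<alpha> \<beta> D Br Cl k
      in four_block_mat (0\<^sub>m (dim_row Y) (dim_col Y)) Y
           Y ((\<alpha> + \<beta>) \<cdot>\<^sub>m T_mat \<alpha> \<beta> D Br Cl k))"

fun Z_mat ::
  "real \<Rightarrow> real \<Rightarrow> real mat \<Rightarrow> real mat \<Rightarrow> real mat \<Rightarrow> nat \<Rightarrow> real mat" where
  "Z_mat \<alpha> \<beta> A Bl Cr 0 = \<beta> \<cdot>\<^sub>m (transpose_mat Cr * inv_mat (shift_mat A \<beta>) * Bl)"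
| "Z_mat \<alpha> \<beta> A Bl Cr (Suc k) =
     (let Z = Z_mat \<alpha> \<beta> A Bl Cr k
      in four_block_mat (0\<^sub>m (dim_row Z) (dim_col Z)) Z
           Z ((\<alpha> + \<beta>) \<cdot>\<^sub>m S_mat \<alpha> \<beta> A Bl Cr k))"

end

theory Submission
  imports Defs
begin

text \<open>For \<open>P \<ge> 0\<close>, the matrix \<open>I - P\<close> is a nonsingular M-matrix as soon as \<open>x \<ge> 0\<close> and \<open>x \<le> P x\<close> imply
\<open>x = 0\<close> (\<open>nonsingular_M_matrix_if_ville\<close>). For \<open>P = Y\<^sub>k Z\<^sub>k\<close> this is proved by interpreting
\<open>Y\<^sub>k\<close> and \<open>Z\<^sub>k\<close> as input-output maps of discrete linear systems.

The matrix \<open>Y\<^sub>k\<close> is block Hankel and vanishes above its block antidiagonal. Up to a reversal of the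
order of the blocks it is a convolution, and its kernel is the impulse response of the system
\<open>\<xi>\<^sub>i\<^sub>+\<^sub>1 - \<xi>\<^sub>i + D (\<alpha> \<xi>\<^sub>i\<^sub>+\<^sub>1 + \<beta> \<xi>\<^sub>i) = C\<^sub>l h\<^sub>i\<close> with output \<open>B\<^sub>r\<^sup>T (\<alpha> \<xi>\<^sub>i\<^sub>+\<^sub>1 + \<beta> \<xi>\<^sub>i)\<close>;
indeed \<open>D\<^sub>\<alpha>\<^sub>,\<^sub>\<beta>\<close> is the transition matrix of this two-point discretization of
\<open>\<xi>' = - D \<xi> + C\<^sub>l h\<close> (\<open>Y_mat_state\<close>). In the same way \<open>Z\<^sub>k\<close> belongs to \<open>A\<close>, with \<open>\<alpha>\<close> and
\<open>\<beta>\<close> interchanged. The bounds on \<open>\<alpha>\<close> and \<open>\<beta>\<close> make all states nonnegative.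

Let \<open>x \<ge> 0\<close> with \<open>x \<le> Y\<^sub>k Z\<^sub>k x\<close>. Because of the reversal, the states \<open>\<eta>\<close> that produce
\<open>Z\<^sub>k x\<close> run in the direction opposite to the states \<open>\<xi>\<close> that produce \<open>Y\<^sub>k (Z\<^sub>k x)\<close>, and
the factorizations of \<open>B\<close> and \<open>C\<close> couple the two. With \<open>a\<close> the sum of all
\<open>\<alpha> \<xi>\<^sub>i\<^sub>+\<^sub>1 + \<beta> \<xi>\<^sub>i\<close> and \<open>b\<close> the corresponding sum for \<open>\<eta>\<close>, the sum of all steps telescopes to
\<open>W (a, b) \<le> 0\<close>, where the left-hand side is bounded by the negative of the final states. A nonsingular
M-matrix then gives \<open>a = 0\<close> and hence \<open>x = 0\<close>. For an irreducible singular one, \<open>W (a, b) = 0\<close>, so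
that both final states vanish, and a support argument carries this back through all steps
(\<open>opposite_marches_vanish\<close>).\<close>

section \<open>Matrices acting on functions\<close>

text \<open>Matrices act here on total functions on the natural numbers rather than on vectors of a fixed
dimension. Sums, scalings and shifted segments of such functions need no dimension bookkeeping, and
the value 0 outside the rows turns \<open>ap_mult\<close> into an equation between functions.\<close>
definition ap :: "real mat \<Rightarrow> (nat \<Rightarrow> real) \<Rightarrow> nat \<Rightarrow> real" where
  "ap M f i = (if i < dim_row M then \<Sum>j<dim_col M. M $$ (i, j) * f j else 0)"

definition nonneg_mat :: "real mat \<Rightarrow> bool" where
  "nonneg_mat M \<longleftrightarrow> (\<forall>i<dim_row M. \<forall>j<dim_col M. 0 \<le> M $$ (i, j))"

lemma ap_cong: "(\<And>j. j < dim_col M \<Longrightarrow> f j = g j) \<Longrightarrow> ap M f = ap M g"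
  by (auto simp: ap_def fun_eq_iff)

lemma ap_add: "ap M (\<lambda>j. f j + g j) i = ap M f i + ap M g i"
  by (simp add: ap_def algebra_simps sum.distrib)

lemma ap_scale: "ap M (\<lambda>j. c * f j) i = c * ap M f i"
  by (simp add: ap_def algebra_simps sum_distrib_left)

lemma ap_zero [simp]: "ap M (\<lambda>j. 0) i = 0"
  by (simp add: ap_def)

lemma ap_sum: "ap M (\<lambda>j. \<Sum>k\<in>K. f k j) i = (\<Sum>k\<in>K. ap M (f k) i)"
proof -
  have "(\<Sum>j<dim_col M. M $$ (i, j) * (\<Sum>k\<in>K. f k j))
      = (\<Sum>k\<in>K. \<Sum>j<dim_col M. M $$ (i, j) * f k j)"
    unfolding sum_distrib_left by (rule sum.swap)
  then show ?thesis by (simp add: ap_def)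
qed

lemma ap_mult:
  assumes "dim_col M = dim_row N"
  shows "ap (M * N) f = ap M (ap N f)"
proof
  fix i
  show "ap (M * N) f i = ap M (ap N f) i"
  proof (cases "i < dim_row M")
    case True
    have "ap (M * N) f i
        = (\<Sum>j<dim_col N. \<Sum>k<dim_row N. M $$ (i, k) * N $$ (k, j) * f j)"
      using True assms
      by (simp add: ap_def scalar_prod_def sum_distrib_right atLeast0LessThan)
    also have "\<dots> = (\<Sum>k<dim_row N. \<Sum>j<dim_col N. M $$ (i, k) * N $$ (k, j) * f j)"
      by (rule sum.swap)
    also have "\<dots> = ap M (ap N f) i"
      using True assms by (simp add: ap_def sum_distrib_left mult.assoc)
    finally show ?thesis .
  qed (simp add: ap_def)
qed

lemma ap_one: "i < n \<Longrightarrow> ap (1\<^sub>m n) f i = f i"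
  by (simp add: ap_def if_distrib[of "\<lambda>x. x * _"] cong: if_cong)

lemma ap_smult: "ap (c \<cdot>\<^sub>m M) f i = c * ap M f i"
  by (simp add: ap_def sum_distrib_left mult.assoc)

lemma ap_add_mat:
  assumes "dim_row M = dim_row N" "dim_col M = dim_col N"
  shows "ap (M + N) f i = ap M f i + ap N f i"
  using assms by (simp add: ap_def algebra_simps sum.distrib)

lemma ap_minus_mat:
  assumes "dim_row M = dim_row N" "dim_col M = dim_col N"
  shows "ap (M - N) f i = ap M f i - ap N f i"
  using assms by (simp add: ap_def algebra_simps sum_subtractf)

lemma ap_zero_mat [simp]: "ap (0\<^sub>m n l) f i = 0"
  by (simp add: ap_def)

lemma ap_shift:
  assumes "M \<in> carrier_mat n n" "i < n"
  shows "ap (shift_mat M t) f i = t * ap M f i + f i"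
  using assms by (simp add: shift_mat_def ap_add_mat ap_smult ap_one)

lemma ap_nonneg:
  assumes "nonneg_mat M" "\<And>j. j < dim_col M \<Longrightarrow> 0 \<le> f j"
  shows "0 \<le> ap M f i"
  using assms by (auto simp: ap_def nonneg_mat_def intro!: sum_nonneg)

lemma ap_mono:
  assumes "nonneg_mat M" "\<And>j. j < dim_col M \<Longrightarrow> f j \<le> g j"
  shows "ap M f i \<le> ap M g i"
  using assms by (auto simp: ap_def nonneg_mat_def intro!: sum_mono mult_left_mono)

lemma mult_mat_vec_ap:
  "i < dim_row M \<Longrightarrow> dim_vec v = dim_col M \<Longrightarrow> (M *\<^sub>v v) $ i = ap M (\<lambda>j. v $ j) i"
  by (simp add: ap_def scalar_prod_def atLeast0LessThan)

lemma nonneg_mat_if_ap: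
  assumes "\<And>f i. (\<And>j. 0 \<le> f j) \<Longrightarrow> i < dim_row M \<Longrightarrow> 0 \<le> ap M f i"
  shows "nonneg_mat M"
  unfolding nonneg_mat_def
proof (intro allI impI)
  fix i j assume ij: "i < dim_row M" "j < dim_col M"
  have "0 \<le> ap M (\<lambda>k. if k = j then 1 else 0) i"
    by (rule assms) (use ij in auto)
  then show "0 \<le> M $$ (i, j)"
    using ij by (simp add: ap_def if_distrib[of "\<lambda>x. _ * x"] cong: if_cong)
qed

lemma nonneg_mult:
  assumes "nonneg_mat M" "nonneg_mat N" "dim_col M = dim_row N"
  shows "nonneg_mat (M * N)"
  using assms by (intro nonneg_mat_if_ap) (simp add: ap_mult ap_nonneg)

lemma nonneg_smult: "nonneg_mat M \<Longrightarrow> 0 \<le> c \<Longrightarrow> nonneg_mat (c \<cdot>\<^sub>m M)"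
  by (simp add: nonneg_mat_def)

lemma nonneg_transpose: "nonneg_mat M \<Longrightarrow> nonneg_mat (transpose_mat M)"
  by (simp add: nonneg_mat_def)

lemma nonneg_mat_iff: "nonneg_mat M \<longleftrightarrow> 0\<^sub>m (dim_row M) (dim_col M) \<le> M"
  by (auto simp: nonneg_mat_def less_eq_mat_def)

section \<open>Z-matrices, M-matrices and subinvariant vectors\<close>

definition Z_matrix :: "real mat \<Rightarrow> bool" where
  "Z_matrix M \<longleftrightarrow> (\<forall>i<dim_row M. \<forall>j<dim_row M. i \<noteq> j \<longrightarrow> M $$ (i, j) \<le> 0)"

text \<open>A Z-matrix is nonsingular with nonnegative inverse exactly if it has this uniqueness property, one
of the two alternatives in Ville's theorem. For \<open>M = I - P\<close> with \<open>P \<ge> 0\<close> it says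
that \<open>x \<ge> 0\<close> and \<open>x \<le> P x\<close> force \<open>x = 0\<close>; all spectral statements below are reduced to it.\<close>
definition ville :: "real mat \<Rightarrow> bool" where
  "ville M \<longleftrightarrow>
     (\<forall>x. (\<forall>i<dim_row M. 0 \<le> x i) \<longrightarrow> (\<forall>i<dim_row M. ap M x i \<le> 0) \<longrightarrow>
        (\<forall>i<dim_row M. x i = 0))"

lemma villeD:
  assumes "ville M" "\<And>i. i < dim_row M \<Longrightarrow> 0 \<le> x i" "\<And>i. i < dim_row M \<Longrightarrow> ap M x i \<le> 0"
    "i < dim_row M"
  shows "x i = 0"
  using assms unfolding ville_def by blast

text \<open>The negative part of \<open>y\<close> is a nonnegative vector that \<open>M\<close> maps to a nonpositive one: on rows where
\<open>y\<close> is nonpositive the positive part of \<open>y\<close> only helps, on the other rows only off-diagonal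
entries contribute.\<close>
lemma Z_matrix_inverse_positive:
  assumes M: "M \<in> carrier_mat n n" and Z: "Z_matrix M" and v: "ville M"
    and y: "\<And>i. i < n \<Longrightarrow> 0 \<le> ap M y i" and i: "i < n"
  shows "0 \<le> y i"
proof -
  define x where "x j = max 0 (- y j)" for j
  have "x i = 0"
  proof (rule villeD[OF v])
    fix k assume "k < dim_row M"
    then have k: "k < n" using M by simp
    show "ap M x k \<le> 0"
    proof (cases "y k \<le> 0")
      case True
      have "ap M x k \<le> - ap M y k"
      proof -
        have "M $$ (k, j) * x j \<le> - (M $$ (k, j) * y j)" if "j < n" for j
        proof (cases "j = k")
          case True
          have "x k = - y k" using \<open>y k \<le> 0\<close> by (simp add: x_def)
          then show ?thesis unfolding True by simp
        next
          case False
          then have "M $$ (k, j) \<le> 0" using Z M k that by (auto simp: Z_matrix_def)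
          then have "M $$ (k, j) * x j \<le> M $$ (k, j) * (- y j)"
            by (intro mult_left_mono_neg) (auto simp: x_def)
          then show ?thesis by simp
        qed
        then have "(\<Sum>j<n. M $$ (k, j) * x j) \<le> (\<Sum>j<n. - (M $$ (k, j) * y j))"
          by (intro sum_mono) auto
        then show ?thesis using M k by (simp add: ap_def sum_negf)
      qed
      then show ?thesis using y[OF k] by linarith
    next
      case False
      have "M $$ (k, j) * x j \<le> 0" if "j < n" for j
      proof (cases "j = k")
        case True
        have "x k = 0" using False by (simp add: x_def)
        then show ?thesis unfolding True by simp
      next
        case False
        then have "M $$ (k, j) \<le> 0" using Z M k that by (auto simp: Z_matrix_def)
        then show ?thesis by (intro mult_nonpos_nonneg) (auto simp: x_def)
      qed
      then show ?thesis using M k by (auto simp: ap_def intro: sum_nonpos)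
    qed
  qed (use M i in \<open>auto simp: x_def\<close>)
  then show ?thesis by (simp add: x_def)
qed

text \<open>Inverse positivity applied to a kernel vector and to its negative makes \<open>M\<close> injective.\<close>
lemma Z_matrix_ville_inverse:
  assumes M: "M \<in> carrier_mat n n" and Z: "Z_matrix M" and v: "ville M"
  shows "inv_mat M \<in> carrier_mat n n" and "M * inv_mat M = 1\<^sub>m n"
    and "inv_mat M * M = 1\<^sub>m n" and "nonneg_mat (inv_mat M)"
proof -
  have "det M \<noteq> 0"
  proof
    assume "det M = 0"
    then obtain w where w: "w \<in> carrier_vec n" "w \<noteq> 0\<^sub>v n" "M *\<^sub>v w = 0\<^sub>v n"
      using det_0_iff_vec_prod_zero_field[OF M] by blast
    have 0: "ap M (\<lambda>j. w $ j) i = 0" if "i < n" for i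
    proof -
      have "ap M (\<lambda>j. w $ j) i = (M *\<^sub>v w) $ i"
        using w(1) M that by (subst mult_mat_vec_ap) auto
      then show ?thesis using that by (simp add: w(3))
    qed
    have 1: "ap M (\<lambda>j. (-1) * w $ j) i = 0" if "i < n" for i
      unfolding ap_scale using 0[OF that] by simp
    have "w $ i = 0" if "i < n" for i
    proof (rule antisym)
      show "w $ i \<ge> 0"
        by (rule Z_matrix_inverse_positive[OF M Z v _ that]) (simp add: 0)
      have "0 \<le> (-1) * w $ i"
        by (rule Z_matrix_inverse_positive[OF M Z v _ that]) (simp only: 1)
      then show "w $ i \<le> 0" by simp
    qed
    then have "w = 0\<^sub>v n" using w(1) by (intro eq_vecI) auto
    with w(2) show False ..
  qed
  from det_non_zero_imp_unit[OF M this, of "()"] mat_inverse(1)[OF M, of "()"]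
  obtain R where "mat_inverse M = Some R" by fastforce
  then have R: "inv_mat M = R" by (simp add: inv_mat_def)
  show c: "inv_mat M \<in> carrier_mat n n" and MR: "M * inv_mat M = 1\<^sub>m n"
    and "inv_mat M * M = 1\<^sub>m n"
    using mat_inverse(2)[OF M \<open>mat_inverse M = Some R\<close>] by (auto simp: R)
  show "nonneg_mat (inv_mat M)"
  proof (rule nonneg_mat_if_ap)
    fix f :: "nat \<Rightarrow> real" and i
    assume f: "\<And>j. 0 \<le> f j" and i: "i < dim_row (inv_mat M)"
    have "ap M (ap (inv_mat M) f) = ap (1\<^sub>m n) f"
      using ap_mult[of M "inv_mat M" f] c M by (simp add: MR)
    then show "0 \<le> ap (inv_mat M) f i"
      using i c f by (intro Z_matrix_inverse_positive[OF M Z v, of "ap (inv_mat M) f"]) (auto simp: ap_one)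
  qed
qed

text \<open>The Collatz-Wielandt bound. If \<open>R\<close> is \<open>N\<close> scaled by a number strictly between the spectral radius
and \<open>t\<close>, then the powers of \<open>R\<close> stay bounded, whereas \<open>x\<close> grows geometrically under \<open>R\<close> unless it
vanishes.\<close>
lemma subinvariant_zero:
  assumes N: "N \<in> carrier_mat n n" and N0: "nonneg_mat N" and t: "rho N < t"
    and x0: "\<And>i. i < n \<Longrightarrow> 0 \<le> x i" and x: "\<And>i. i < n \<Longrightarrow> t * x i \<le> ap N x i"
    and i: "i < n"
  shows "x i = 0"
proof -
  let ?N = "map_mat complex_of_real N"
  have cN: "?N \<in> carrier_mat n n" and n: "n > 0" using N i by auto
  have r: "rho N = spectral_radius ?N" using n N by (simp add: rho_def)
  have "0 \<le> rho N" using spectral_radius_mem_max(1)[OF cN n] by (auto simp: r)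
  define u where "u = (rho N + t) / 2"
  have u: "rho N < u" "u < t" "0 < u" using t \<open>0 \<le> rho N\<close> by (auto simp: u_def)
  define R where "R = (1 / u) \<cdot>\<^sub>m N"
  let ?R = "map_mat complex_of_real R"
  have R: "R \<in> carrier_mat n n" and cR: "?R \<in> carrier_mat n n" using N by (auto simp: R_def)
  have R0: "nonneg_mat R" using N0 u by (simp add: R_def nonneg_smult)
  have RN: "?R = complex_of_real (1 / u) \<cdot>\<^sub>m ?N" by (auto simp: R_def)
  have "spectral_radius ?R < 1"
  proof -
    from spectral_radius_mem_max(1)[OF cR n] obtain e where
      e: "e \<in> spectrum ?R" "spectral_radius ?R = norm e" by auto
    then obtain v where v: "v \<in> carrier_vec n" "v \<noteq> 0\<^sub>v n" "?R *\<^sub>v v = e \<cdot>\<^sub>v v"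
      using cR by (auto simp: spectrum_def eigenvalue_def eigenvector_def)
    have "?N = complex_of_real u \<cdot>\<^sub>m ?R"
      using u N by (auto simp: RN intro!: eq_matI)
    then have "?N *\<^sub>v v = complex_of_real u \<cdot>\<^sub>v (?R *\<^sub>v v)"
      using cR v(1) by (auto simp: scalar_prod_def sum_distrib_left mult.assoc intro!: eq_vecI)
    also have "\<dots> = (u * e) \<cdot>\<^sub>v v" using v by (simp add: smult_smult_assoc)
    finally have "u * e \<in> spectrum ?N"
      using v cN by (auto simp: spectrum_def eigenvalue_def eigenvector_def)
    then have "norm (u * e) \<le> rho N"
      using spectral_radius_mem_max(2)[OF cN n, of "norm (u * e)"] r by auto
    then have "u * norm e < u * 1" using u(1,3) by (simp only: norm_mult norm_of_real)
    then have "norm e < 1" using u(3) by (simp only: mult_less_cancel_left_pos)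
    then show ?thesis using e by simp
  qed
  from spectral_radius_jnf_norm_bound_less_1_upper_triangular[OF cR this]
  obtain c where c: "norm_bound (?R ^\<^sub>m k) c" for k by auto
  have pw: "?R ^\<^sub>m k = map_mat complex_of_real (R ^\<^sub>m k)" for k
    by (rule of_real_hom.mat_hom_pow[OF R, symmetric])
  have dR: "R ^\<^sub>m k \<in> carrier_mat n n" for k using R by simp
  have bd: "\<bar>(R ^\<^sub>m k) $$ (a, b)\<bar> \<le> c" if "a < n" "b < n" for k a b
    using c[of k] that dR[of k] R unfolding norm_bound_def pw by auto
  have Rk0: "nonneg_mat (R ^\<^sub>m k)" for k
    by (induction k) (use R R0 dR in \<open>auto simp: nonneg_mat_def[of "1\<^sub>m _"] intro!: nonneg_mult\<close>)
  define g where "g = t / u"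
  have g: "1 < g" using u by (simp add: g_def)
  have Rx: "g * x j \<le> ap R x j" if "j < n" for j
    using x[OF that] u by (simp add: R_def ap_smult g_def divide_right_mono)
  have grow: "g ^ k * x j \<le> ap (R ^\<^sub>m k) x j" if "j < n" for k j
  proof (induction k)
    case 0
    show ?case using that R by (simp add: ap_one)
  next
    case (Suc k)
    have "g ^ Suc k * x j = g * (g ^ k * x j)" by simp
    also have "\<dots> \<le> g * ap (R ^\<^sub>m k) x j" using Suc g by (intro mult_left_mono) auto
    also have "\<dots> = ap (R ^\<^sub>m k) (\<lambda>j. g * x j) j" by (simp add: ap_scale)
    also have "\<dots> \<le> ap (R ^\<^sub>m k) (ap R x) j" using Rk0 dR[of k] Rx by (intro ap_mono) auto
    also have "\<dots> = ap (R ^\<^sub>m Suc k) x j" using R dR[of k] by (simp add: ap_mult)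
    finally show ?case .
  qed
  have bound: "g ^ k * x i \<le> c * (\<Sum>j<n. x j)" for k
  proof -
    have "g ^ k * x i \<le> (\<Sum>j<n. (R ^\<^sub>m k) $$ (i, j) * x j)"
      using grow[OF i, of k] carrier_matD[OF dR[of k]] i by (simp only: ap_def) simp
    also have "\<dots> \<le> (\<Sum>j<n. c * x j)"
      using bd[OF i] x0 by (intro sum_mono mult_right_mono) (auto simp: abs_le_iff)
    finally show ?thesis by (simp add: sum_distrib_left)
  qed
  show ?thesis
  proof (rule ccontr)
    assume "x i \<noteq> 0"
    then have xi: "0 < x i" using x0[OF i] by simp
    from real_arch_pow[OF g, of "c * (\<Sum>j<n. x j) / x i"] obtain k
      where "c * (\<Sum>j<n. x j) / x i < g ^ k" by blast
    then have "c * (\<Sum>j<n. x j) < g ^ k * x i" using xi by (simp add: field_simps)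
    with bound[of k] show False by simp
  qed
qed

text \<open>The moduli of the entries of an eigenvector of \<open>P\<close> whose eigenvalue has modulus at least 1 form a
vector \<open>x\<close> with \<open>x \<le> P x\<close>.\<close>
lemma nonsingular_M_matrix_if_ville:
  assumes P: "P \<in> carrier_mat n n" and P0: "nonneg_mat P" and v: "ville (1\<^sub>m n - P)"
  shows "nonsingular_M_matrix (1\<^sub>m n - P)"
proof -
  let ?P = "map_mat complex_of_real P"
  have M: "1\<^sub>m n - P \<in> carrier_mat n n" using P by (simp add: minus_carrier_mat)
  have Z: "Z_matrix (1\<^sub>m n - P)" using P P0 by (auto simp: Z_matrix_def nonneg_mat_def)
  have "invertible_mat (1\<^sub>m n - P)"
    using Z_matrix_ville_inverse[OF M Z v] M P
    unfolding invertible_mat_def inverts_mat_def by (intro conjI exI[of _ "inv_mat (1\<^sub>m n - P)"]) auto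
  moreover have "rho P \<le> 1"
  proof (cases "n = 0")
    case True
    then show ?thesis using P by (simp add: rho_def)
  next
    case False
    have cP: "?P \<in> carrier_mat n n" using P by simp
    from spectral_radius_mem_max(1)[OF cP] False obtain e where
      e: "e \<in> spectrum ?P" "spectral_radius ?P = norm e" by auto
    then obtain w where w: "w \<in> carrier_vec n" "w \<noteq> 0\<^sub>v n" "?P *\<^sub>v w = e \<cdot>\<^sub>v w"
      using cP by (auto simp: spectrum_def eigenvalue_def eigenvector_def)
    have "norm e \<le> 1"
    proof (rule ccontr)
      assume e1: "\<not> norm e \<le> 1"
      have "norm (w $ i) = 0" if i: "i < n" for i
      proof (rule villeD[OF v, where x = "\<lambda>i. norm (w $ i)"])
        fix i assume "i < dim_row (1\<^sub>m n - P)"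
        then have i: "i < n" using P by simp
        have "norm (w $ i) \<le> norm e * norm (w $ i)"
          using e1 by (simp add: mult_le_cancel_right1)
        also have "\<dots> = norm ((?P *\<^sub>v w) $ i)" using w i by (simp add: norm_mult)
        also have "(?P *\<^sub>v w) $ i = (\<Sum>j<n. of_real (P $$ (i, j)) * w $ j)"
          using w(1) P i by (simp add: scalar_prod_def atLeast0LessThan)
        also have "norm \<dots> \<le> (\<Sum>j<n. norm (of_real (P $$ (i, j)) * w $ j))" by (rule norm_sum)
        also have "\<dots> = ap P (\<lambda>i. norm (w $ i)) i"
          using P P0 i by (auto simp: ap_def norm_mult nonneg_mat_def intro!: sum.cong)
        finally show "ap (1\<^sub>m n - P) (\<lambda>i. norm (w $ i)) i \<le> 0"
          using P i by (simp add: ap_minus_mat ap_one)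
      qed (use P i in auto)
      then show False using w by auto
    qed
    then show ?thesis using e P False by (simp add: rho_def)
  qed
  moreover have "1\<^sub>m n - P = 1 \<cdot>\<^sub>m 1\<^sub>m n - P" using P by (intro eq_matI) auto
  ultimately show ?thesis
    using P P0 unfolding nonsingular_M_matrix_def M_matrix_def
    by (auto simp: nonneg_mat_iff intro!: exI[of _ 1] exI[of _ P])
qed

lemma M_matrixE:
  assumes "M_matrix W" "W \<in> carrier_mat n n"
  obtains s N where "N \<in> carrier_mat n n" "nonneg_mat N" "rho N \<le> s" "W = s \<cdot>\<^sub>m 1\<^sub>m n - N"
proof -
  have d: "dim_row W = n" using assms(2) by simp
  from assms(1) obtain s N where *: "N \<in> carrier_mat n n" "0\<^sub>m n n \<le> N" "rho N \<le> s"
    "W = s \<cdot>\<^sub>m 1\<^sub>m n - N"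
    unfolding M_matrix_def d by blast
  moreover from * have "nonneg_mat N" by (simp add: nonneg_mat_iff)
  ultimately show ?thesis using that by blast
qed

lemma M_matrix_Z_matrix:
  assumes "M_matrix W" "W \<in> carrier_mat n n"
  shows "Z_matrix W"
proof -
  obtain s N where "N \<in> carrier_mat n n" "nonneg_mat N" "W = s \<cdot>\<^sub>m 1\<^sub>m n - N"
    using M_matrixE[OF assms] by blast
  then show ?thesis by (auto simp: Z_matrix_def nonneg_mat_def)
qed

text \<open>A possibly singular M-matrix becomes nonsingular after adding any positive multiple of the identity,
because its representation then has a shift strictly above the spectral radius.\<close>
lemma M_matrix_shift_ville:
  assumes W: "M_matrix W" "W \<in> carrier_mat n n" and t: "0 \<le> t"
  shows "ville (shift_mat W t)"
  unfolding ville_def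
proof (intro allI impI)
  fix x i
  assume x: "\<forall>i<dim_row (shift_mat W t). 0 \<le> x i"
    "\<forall>i<dim_row (shift_mat W t). ap (shift_mat W t) x i \<le> 0" and i: "i < dim_row (shift_mat W t)"
  have d: "dim_row (shift_mat W t) = n" using W by (simp add: shift_mat_def)
  obtain s N where N: "N \<in> carrier_mat n n" "nonneg_mat N" "rho N \<le> s" "W = s \<cdot>\<^sub>m 1\<^sub>m n - N"
    using M_matrixE[OF W] by blast
  have W': "ap W x j = s * x j - ap N x j" if "j < n" for j
    using N that by (simp add: ap_minus_mat ap_smult ap_one)
  have le: "t * (s * x j - ap N x j) + x j \<le> 0" if "j < n" for j
    using x(2) that by (simp add: d ap_shift[OF W(2)] W')
  show "x i = 0"
  proof (cases "t = 0")
    case True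
    with le[of i] x(1)[rule_format, OF i] i[unfolded d] show ?thesis by simp
  next
    case False
    show ?thesis
    proof (rule subinvariant_zero[OF N(1,2)])
      have "0 < 1 / t" using t False by simp
      then show "rho N < s + 1 / t" using N(3) by linarith
      show "(s + 1 / t) * x j \<le> ap N x j" if "j < n" for j
        using le[OF that] t False by (simp add: field_simps)
    qed (use x i d in auto)
  qed
qed

text \<open>Invertibility has to exclude that the shift \<open>s\<close> in \<open>W = s I - N\<close> equals the spectral radius. Instead
of invoking the Perron-Frobenius theorem, the proof solves \<open>W u = 1\<close>: adding a small multiple of the
identity to \<open>W\<close> keeps the right-hand side nonnegative, hence \<open>u \<ge> 0\<close>, hence even \<open>u > 0\<close>. A vector
\<open>x \<ge> 0\<close> with \<open>W x \<le> 0\<close> is then compared with \<open>u\<close> at the index where \<open>x / u\<close> is largest.\<close>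
lemma nonsingular_M_matrix_ville:
  assumes W: "nonsingular_M_matrix W" "W \<in> carrier_mat n n"
  shows "ville W"
  unfolding ville_def
proof (intro allI impI)
  fix x i
  assume x: "\<forall>i<dim_row W. 0 \<le> x i" "\<forall>i<dim_row W. ap W x i \<le> 0" and i: "i < dim_row W"
  have d: "dim_row W = n" using W by simp
  have M: "M_matrix W" and "invertible_mat W" using W(1) by (auto simp: nonsingular_M_matrix_def)
  then obtain R where R: "inverts_mat W R" "inverts_mat R W" by (auto simp: invertible_mat_def)
  have WR: "W * R = 1\<^sub>m n" using R(1) d by (simp add: inverts_mat_def)
  have "R * W = 1\<^sub>m (dim_row R)" using R(2) by (simp add: inverts_mat_def)
  then have "dim_row R = n"
    using W(2) by (metis carrier_matD(2) index_mult_mat(3) index_one_mat(3))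
  obtain s N where N: "N \<in> carrier_mat n n" "nonneg_mat N" "W = s \<cdot>\<^sub>m 1\<^sub>m n - N"
    using M_matrixE[OF M W(2)] by blast
  have W': "ap W f j = s * f j - ap N f j" if "j < n" for j f
    using N that by (simp add: ap_minus_mat ap_smult ap_one)
  define u where "u = ap R (\<lambda>_. 1)"
  have Wu: "ap W u j = 1" if "j < n" for j
  proof -
    have "ap W u = ap (W * R) (\<lambda>_. 1)"
      unfolding u_def using \<open>dim_row R = n\<close> W(2) by (subst ap_mult) auto
    then show ?thesis using that by (simp add: WR ap_one)
  qed
  have u0: "0 \<le> u j" if j: "j < n" for j
  proof -
    \<comment> \<open>\<open>t W + I\<close> maps \<open>u\<close> to \<open>t + u\<close>, which is nonnegative for this \<open>t\<close>.\<close>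
    define t where "t = (\<Sum>j<n. \<bar>u j\<bar>)"
    have t: "0 \<le> t" by (simp add: t_def sum_nonneg)
    have "\<bar>u k\<bar> \<le> t" if "k < n" for k
      unfolding t_def using that by (intro member_le_sum) auto
    then have "0 \<le> ap (shift_mat W t) u k" if "k < n" for k
      using that Wu[OF that] by (fastforce simp: ap_shift[OF W(2)] abs_le_iff)
    moreover have "Z_matrix (shift_mat W t)"
      using M_matrix_Z_matrix[OF M W(2)] W(2) t
      by (auto simp: Z_matrix_def shift_mat_def mult_nonneg_nonpos)
    ultimately show ?thesis
      using M_matrix_shift_ville[OF M W(2) t] W(2) j
      by (intro Z_matrix_inverse_positive[of "shift_mat W t" n u j]) (auto simp: shift_mat_def)
  qed
  have su: "s * u j = 1 + ap N u j" and su1: "1 \<le> s * u j" if "j < n" for j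
    using Wu[OF that] W'[OF that] ap_nonneg[OF N(2), of u j] u0 N(1) that by force+
  have upos: "0 < u j" if "j < n" for j
    using su1[OF that] u0[OF that] by (cases "u j = 0") auto
  define c where "c = Max ((\<lambda>j. x j / u j) ` {..<n})"
  have fin: "finite ((\<lambda>j. x j / u j) ` {..<n})" "(\<lambda>j. x j / u j) ` {..<n} \<noteq> {}"
    using i d by auto
  have xc: "x j \<le> c * u j" if "j < n" for j
  proof -
    have "x j / u j \<le> c" unfolding c_def using that fin by (intro Max_ge) auto
    then show ?thesis using upos[OF that] by (simp add: field_simps)
  qed
  from Max_in[OF fin] obtain k where k: "k < n" "c = x k / u k" by (auto simp: c_def)
  then have xk: "x k = c * u k" using upos[of k] by simp
  have "0 \<le> c" using k x(1) upos[of k] d by simp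
  have "s * x k \<le> ap N x k" using x(2) W'[OF k(1)] k d by fastforce
  also have "\<dots> \<le> ap N (\<lambda>j. c * u j) k" using N xc by (intro ap_mono) auto
  also have "\<dots> = c * (s * u k - 1)" using su[OF k(1)] by (simp add: ap_scale)
  finally have "c \<le> 0" unfolding xk by (simp add: algebra_simps)
  then have "x i \<le> 0" using xc[of i] upos[of i] i d \<open>0 \<le> c\<close> by simp
  then show "x i = 0" using x(1) i by (simp add: order.antisym)
qed

text \<open>On a row where \<open>z\<close> vanishes, \<open>W z\<close> is a sum of nonpositive terms; if it is nonnegative, all terms are
zero. The zero set of \<open>z\<close> then splits off a block.\<close>
lemma irreducible_support:
  assumes W: "W \<in> carrier_mat n n" and Z: "Z_matrix W" and irr: "irreducible_mat W"
    and z0: "\<And>i. i < n \<Longrightarrow> 0 \<le> z i"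
    and z: "\<And>i. i < n \<Longrightarrow> z i = 0 \<Longrightarrow> 0 \<le> ap W z i"
  shows "(\<forall>i<n. z i = 0) \<or> (\<forall>i<n. 0 < z i)"
proof (rule ccontr)
  assume *: "\<not> ?thesis"
  define J where "J = {i. i < n \<and> z i = 0}"
  have "J \<noteq> {}" using * z0 by (fastforce simp: J_def)
  moreover have "J \<subset> {..<n}" using * by (auto simp: J_def)
  moreover have "W $$ (i, j) = 0" if i: "i \<in> J" and j: "j \<in> {..<n} - J" for i j
  proof -
    have i': "i < n" "z i = 0" and j': "j < n" "z j \<noteq> 0" "0 < z j"
      using i j z0[of j] by (auto simp: J_def)
    have le: "W $$ (i, l) * z l \<le> 0" if "l < n" for l
      using Z W i' that z0[OF that]
      by (cases "l = i") (auto simp: Z_matrix_def mult_nonpos_nonneg)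
    have "0 \<le> (\<Sum>l<n. W $$ (i, l) * z l)" using z[OF i'] W i' by (simp add: ap_def)
    also have "\<dots> \<le> W $$ (i, j) * z j"
      using le j' by (subst sum.remove[of _ j]) (auto intro!: sum_nonpos)
    finally have "0 \<le> W $$ (i, j)" using j' by (simp add: zero_le_mult_iff)
    moreover have "i \<noteq> j" using i' j' by auto
    then have "W $$ (i, j) \<le> 0" using Z W i' j' by (auto simp: Z_matrix_def)
    ultimately show ?thesis by simp
  qed
  ultimately have "reducible_mat W" using W unfolding reducible_mat_def by auto
  then show False using irr by (simp add: irreducible_mat_def)
qed

text \<open>Suppose that \<open>r = - W v\<close> is nonzero. If \<open>r > 0\<close>, a small positive multiple of \<open>v\<close> can be added to
\<open>W v\<close>, against \<open>M_matrix_shift_ville\<close>. Otherwise the step from \<open>v\<close> to \<open>v + t r\<close> with small \<open>t\<close>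
keeps the positive entries of \<open>r\<close> positive and, by irreducibility, creates a new one; hence the
induction on the number of zeros of \<open>W v\<close>.\<close>
lemma irreducible_M_matrix_null:
  assumes W: "W \<in> carrier_mat n n" and M: "M_matrix W" and irr: "irreducible_mat W"
    and v0: "\<And>i. i < n \<Longrightarrow> 0 \<le> v i" and v: "\<And>i. i < n \<Longrightarrow> ap W v i \<le> 0"
  shows "\<forall>i<n. ap W v i = 0"
  using v0 v
proof (induction "card {i. i < n \<and> ap W v i = 0}" arbitrary: v rule: less_induct)
  case less
  define r where "r i = - ap W v i" for i
  have Z: "Z_matrix W" by (rule M_matrix_Z_matrix[OF M W])
  have r0: "0 \<le> r i" if "i < n" for i using less.prems(2)[OF that] by (simp add: r_def)
  show ?case
  proof (rule ccontr)
    assume nz: "\<not> ?thesis"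
    show False
    proof (cases "\<forall>i<n. 0 < r i")
      case True
      define t where "t = (\<Sum>i<n. v i / r i)"
      have v_div: "0 \<le> v i / r i" if "i < n" for i
        using r0[OF that] less.prems(1)[OF that] by simp
      then have "0 \<le> t" unfolding t_def by (intro sum_nonneg) auto
      have vr: "v i \<le> t * r i" if "i < n" for i
      proof -
        have "v i / r i \<le> t" unfolding t_def using that v_div by (intro member_le_sum) auto
        then show ?thesis using True that by (simp add: field_simps)
      qed
      have "ap (shift_mat W t) v i \<le> 0" if "i < n" for i
        unfolding ap_shift[OF W that] using vr[OF that] by (simp add: r_def)
      then have "\<forall>i<n. v i = 0"
        using M_matrix_shift_ville[OF M W \<open>0 \<le> t\<close>] less.prems(1) W
        by (auto intro!: villeD[of "shift_mat W t" v] simp: shift_mat_def)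
      then have "ap W v = ap W (\<lambda>_. 0)" using W by (intro ap_cong) auto
      with nz show False by simp
    next
      case False
      have "\<not> (\<forall>i<n. r i = 0)" using nz by (auto simp: r_def)
      then have "\<exists>i<n. r i = 0 \<and> ap W r i < 0"
        using irreducible_support[OF W Z irr, of r] r0 False by (meson not_le)
      then obtain l where l: "l < n" "r l = 0" "ap W r l < 0" by blast
      \<comment> \<open>Small enough for \<open>t W\<close> to have all diagonal entries below 1.\<close>
      define t where "t = 1 / (1 + (\<Sum>i<n. \<bar>W $$ (i, i)\<bar>))"
      have S: "0 \<le> (\<Sum>i<n. \<bar>W $$ (i, i)\<bar>)" by (intro sum_nonneg) auto
      then have t: "0 < t" by (simp add: t_def add_pos_nonneg)
      have tW: "t * W $$ (i, i) < 1" if "i < n" for i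
      proof -
        have "\<bar>W $$ (i, i)\<bar> \<le> (\<Sum>i<n. \<bar>W $$ (i, i)\<bar>)" using that by (intro member_le_sum) auto
        then have "W $$ (i, i) < 1 + (\<Sum>i<n. \<bar>W $$ (i, i)\<bar>)" by linarith
        then show ?thesis using S by (simp add: t_def add_pos_nonneg field_simps)
      qed
      have Wr: "ap W r i \<le> W $$ (i, i) * r i" if "i < n" for i
      proof -
        have "W $$ (i, j) * r j \<le> 0" if "j < n" "j \<noteq> i" for j
          using Z W that \<open>i < n\<close> r0[of j] by (auto simp: Z_matrix_def mult_nonpos_nonneg)
        then have "(\<Sum>j\<in>{..<n} - {i}. W $$ (i, j) * r j) \<le> 0" by (intro sum_nonpos) auto
        then show ?thesis using W that by (simp add: ap_def sum.remove[of "{..<n}" i])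
      qed
      define z where "z i = v i + t * r i" for i
      have Wz: "ap W z i = t * ap W r i - r i" for i
        unfolding z_def ap_add ap_scale by (simp add: r_def)
      have Wz_neg: "ap W z i < 0" if "i < n" "0 < r i" for i
      proof -
        have "t * ap W r i \<le> t * (W $$ (i, i) * r i)"
          using Wr[OF that(1)] t by (intro mult_left_mono) auto
        also have "\<dots> < 1 * r i"
          unfolding mult.assoc[symmetric] using tW[OF that(1)] that(2)
          by (rule mult_strict_right_mono)
        finally show ?thesis by (simp add: Wz)
      qed
      have Wz_le: "ap W z i \<le> 0" if "i < n" for i
      proof (cases "r i = 0")
        case True
        then show ?thesis using Wr[OF that] t by (simp add: Wz mult_nonneg_nonpos)
      next
        case False
        then show ?thesis using Wz_neg[OF that] r0[OF that] by simp
      qed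
      have "{i. i < n \<and> ap W z i = 0} \<subset> {i. i < n \<and> ap W v i = 0}"
      proof -
        have "l \<in> {i. i < n \<and> ap W v i = 0}" using l by (simp add: r_def)
        moreover have "l \<notin> {i. i < n \<and> ap W z i = 0}" using l t by (simp add: Wz mult_less_0_iff)
        moreover have "{i. i < n \<and> ap W z i = 0} \<subseteq> {i. i < n \<and> ap W v i = 0}"
          using Wz_neg r0 by (force simp: r_def)
        ultimately show ?thesis by blast
      qed
      then have "card {i. i < n \<and> ap W z i = 0} < card {i. i < n \<and> ap W v i = 0}"
        by (intro psubset_card_mono) auto
      moreover have "0 \<le> z i" if "i < n" for i
        using less.prems(1)[OF that] r0[OF that] t by (simp add: z_def)
      ultimately have "\<forall>i<n. ap W z i = 0" using less.hyps[of z] Wz_le by blast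
      then have "ap W z l = 0" using l(1) by blast
      then show False using l t by (simp add: Wz)
    qed
  qed
qed

section \<open>Antitriangular block Hankel matrices\<close>

lemma iter_mat_carrier:
  "M \<in> carrier_mat n n \<Longrightarrow> X \<in> carrier_mat n q \<Longrightarrow> iter_mat M X j \<in> carrier_mat n q"
  by (induction j) auto

text \<open>The matrices \<open>T\<^sub>k\<close> and \<open>S\<^sub>k\<close> are block Hankel for this reason: the powers of the iteration matrix on
the two sides combine to one power.\<close>
lemma transpose_iter_mult:
  assumes E: "E \<in> carrier_mat n n" and G: "G \<in> carrier_mat n p" and K: "K \<in> carrier_mat n q"
  shows "transpose_mat (iter_mat (transpose_mat E) G i) * iter_mat E K j
    = transpose_mat G * iter_mat E K (i + j)"
proof (induction i arbitrary: j)
  case (Suc i)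
  let ?X = "iter_mat (transpose_mat E) G i"
  have X: "?X \<in> carrier_mat n p" using E G by (intro iter_mat_carrier) auto
  have Y: "iter_mat E K j \<in> carrier_mat n q" using E K by (rule iter_mat_carrier)
  have "transpose_mat (iter_mat (transpose_mat E) G (Suc i)) * iter_mat E K j
      = (transpose_mat ?X * E) * iter_mat E K j"
    using X E by (simp add: transpose_mult[where nr = n and n = n and nc = p])
  also have "\<dots> = transpose_mat ?X * (E * iter_mat E K j)"
    using X E Y by (intro assoc_mult_mat) auto
  also have "\<dots> = transpose_mat G * iter_mat E K (Suc i + j)"
    using Suc.IH[of "Suc j"] by simp
  finally show ?case .
qed simp

definition block_hankel :: "nat \<Rightarrow> nat \<Rightarrow> nat \<Rightarrow> (nat \<Rightarrow> real mat) \<Rightarrow> real mat" where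
  "block_hankel p q N f =
     mat (N * p) (N * q) (\<lambda>(i, j). f (i div p + j div q) $$ (i mod p, j mod q))"

lemma block_hankel_carrier [simp]: "block_hankel p q N f \<in> carrier_mat (N * p) (N * q)"
  by (simp add: block_hankel_def)

lemma div_mod_block:
  fixes i p N :: nat
  assumes "i < N * p"
  shows "i div p < N" "i mod p < p"
proof -
  have "0 < p" using assms by (cases p) auto
  then show "i mod p < p" by simp
  show "i div p < N" using assms by (simp add: less_mult_imp_div_less)
qed

lemma block_row_gram:
  assumes X: "\<And>i. X i \<in> carrier_mat n p" and Y: "\<And>i. Y i \<in> carrier_mat n q"
    and f: "\<And>i j. transpose_mat (X i) * Y j = f (i + j)"
  shows "transpose_mat (block_row X N) * block_row Y N = block_hankel p q N f"
proof (rule eq_matI)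
  have dX: "dim_row (X i) = n" "dim_col (X i) = p" for i using X[of i] by auto
  have dY: "dim_row (Y i) = n" "dim_col (Y i) = q" for i using Y[of i] by auto
  fix a b
  assume "a < dim_row (block_hankel p q N f)" "b < dim_col (block_hankel p q N f)"
  then have a: "a < N * p" and b: "b < N * q" by (auto simp: block_hankel_def)
  note a' = div_mod_block[OF a] and b' = div_mod_block[OF b]
  have "(transpose_mat (block_row X N) * block_row Y N) $$ (a, b)
      = (\<Sum>i<n. X (a div p) $$ (i, a mod p) * Y (b div q) $$ (i, b mod q))"
    using a b by (simp add: block_row_def scalar_prod_def dX dY atLeast0LessThan)
  also have "\<dots> = (transpose_mat (X (a div p)) * Y (b div q)) $$ (a mod p, b mod q)"
    using a' b' by (simp add: scalar_prod_def dX dY atLeast0LessThan)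
  finally show "(transpose_mat (block_row X N) * block_row Y N) $$ (a, b)
      = block_hankel p q N f $$ (a, b)"
    using a b by (simp add: block_hankel_def f)
qed (use X[of 0] Y[of 0] in \<open>auto simp: block_row_def block_hankel_def\<close>)

lemma block_hankel_smult:
  assumes "\<And>s. f s \<in> carrier_mat p q"
  shows "c \<cdot>\<^sub>m block_hankel p q N f = block_hankel p q N (\<lambda>s. c \<cdot>\<^sub>m f s)"
proof (rule eq_matI)
  have d: "dim_row (f s) = p" "dim_col (f s) = q" for s using assms[of s] by auto
  fix i j
  assume "i < dim_row (block_hankel p q N (\<lambda>s. c \<cdot>\<^sub>m f s))"
    "j < dim_col (block_hankel p q N (\<lambda>s. c \<cdot>\<^sub>m f s))"
  then have "i < N * p" "j < N * q" by (auto simp: block_hankel_def)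
  then show "(c \<cdot>\<^sub>m block_hankel p q N f) $$ (i, j)
      = block_hankel p q N (\<lambda>s. c \<cdot>\<^sub>m f s) $$ (i, j)"
    using div_mod_block[of i N p] div_mod_block[of j N q] by (simp add: block_hankel_def d)
qed (auto simp: block_hankel_def)

text \<open>The generator of a block Hankel matrix of \<open>N\<close> by \<open>N\<close> blocks that vanishes above the block
antidiagonal and carries \<open>c 0, c 1, \<dots>\<close> on the antidiagonal and below it. Reversing the order of the
block columns turns it into a lower triangular block Toeplitz matrix, that is, into the convolution
with \<open>c\<close>.\<close>
definition anti_triangular :: "nat \<Rightarrow> nat \<Rightarrow> nat \<Rightarrow> (nat \<Rightarrow> real mat) \<Rightarrow> nat \<Rightarrow> real mat" where
  "anti_triangular p q N c s = (if s + 1 < N then 0\<^sub>m p q else c (s + 1 - N))"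

text \<open>The recursion for \<open>Y\<^sub>k\<close> preserves this shape and extends the convolution kernel; the new lower right
block starts with \<open>c 1\<close> because the antidiagonal of the larger matrix passes just above it.\<close>
lemma anti_triangular_double:
  assumes "0 < N"
  shows "four_block_mat (0\<^sub>m (N * p) (N * q)) (block_hankel p q N (anti_triangular p q N c))
      (block_hankel p q N (anti_triangular p q N c)) (block_hankel p q N (\<lambda>s. c (Suc s)))
    = block_hankel p q (2 * N) (anti_triangular p q (2 * N) c)" (is "?L = ?R")
proof (rule eq_matI)
  have split: "i < N * l \<and> i div l < N \<or>
      N * l \<le> i \<and> i - N * l < N * l \<and> N \<le> i div l
      \<and> (i - N * l) div l = i div l - N \<and> (i - N * l) mod l = i mod l"
    if "i < 2 * N * l" for i l :: nat
  proof (cases "i < N * l")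
    case True
    then show ?thesis using div_mod_block by blast
  next
    case False
    have l: "0 < l" using that by (cases l) auto
    obtain k where k: "i = N * l + k" using False by (metis le_add_diff_inverse not_less)
    then show ?thesis using that l by auto
  qed
  fix i j
  assume "i < dim_row ?R" "j < dim_col ?R"
  then have i: "i < 2 * N * p" and j: "j < 2 * N * q" by (auto simp: block_hankel_def)
  note i' = div_mod_block[OF i] and j' = div_mod_block[OF j]
  have L: "?L $$ (i, j) = (if i < N * p
      then if j < N * q then 0 else block_hankel p q N (anti_triangular p q N c) $$ (i, j - N * q)
      else if j < N * q then block_hankel p q N (anti_triangular p q N c) $$ (i - N * p, j)
      else block_hankel p q N (\<lambda>s. c (Suc s)) $$ (i - N * p, j - N * q))"
    using i j by (subst index_mat_four_block) (auto simp: block_hankel_def)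
  have R: "?R $$ (i, j)
      = anti_triangular p q (2 * N) c (i div p + j div q) $$ (i mod p, j mod q)"
    using i j by (simp add: block_hankel_def)
  from split[OF i] show "?L $$ (i, j) = ?R $$ (i, j)"
  proof
    assume si: "i < N * p \<and> i div p < N"
    from split[OF j] show ?thesis
    proof
      assume sj: "j < N * q \<and> j div q < N"
      then have "i div p + j div q + 1 < 2 * N" using si by linarith
      then show ?thesis unfolding L R using si sj i' j' by (simp add: anti_triangular_def)
    next
      assume sj: "N * q \<le> j \<and> j - N * q < N * q \<and> N \<le> j div q
        \<and> (j - N * q) div q = j div q - N \<and> (j - N * q) mod q = j mod q"
      then have "(i div p + (j div q - N) + 1 < N) = (i div p + j div q + 1 < 2 * N)"
        "i div p + (j div q - N) + 1 - N = i div p + j div q + 1 - 2 * N" by linarith+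
      then show ?thesis unfolding L R using si sj
        by (simp add: anti_triangular_def block_hankel_def)
    qed
  next
    assume si: "N * p \<le> i \<and> i - N * p < N * p \<and> N \<le> i div p
        \<and> (i - N * p) div p = i div p - N \<and> (i - N * p) mod p = i mod p"
    from split[OF j] show ?thesis
    proof
      assume sj: "j < N * q \<and> j div q < N"
      then have "(i div p - N + j div q + 1 < N) = (i div p + j div q + 1 < 2 * N)"
        "i div p - N + j div q + 1 - N = i div p + j div q + 1 - 2 * N" using si by linarith+
      then show ?thesis unfolding L R using si sj
        by (simp add: anti_triangular_def block_hankel_def)
    next
      assume sj: "N * q \<le> j \<and> j - N * q < N * q \<and> N \<le> j div q
        \<and> (j - N * q) div q = j div q - N \<and> (j - N * q) mod q = j mod q"
      then have "\<not> (i div p + j div q + 1 < 2 * N)"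
        "Suc (i div p - N + (j div q - N)) = i div p + j div q + 1 - 2 * N" using si by linarith+
      then show ?thesis unfolding L R using si sj
        by (simp add: anti_triangular_def block_hankel_def)
    qed
  qed
qed (auto simp: block_hankel_def)

lemma ap_block_hankel:
  assumes f: "\<And>s. f s \<in> carrier_mat p q" and i: "i < N" and r: "r < p"
  shows "ap (block_hankel p q N f) x (i * p + r) = (\<Sum>j<N. ap (f (i + j)) (\<lambda>c. x (j * q + c)) r)"
proof -
  have d: "dim_row (f s) = p" "dim_col (f s) = q" for s using f[of s] by auto
  have ir: "i * p + r < N * p"
    using mult_le_mono1[of "Suc i" N p] i r by simp
  have "ap (block_hankel p q N f) x (i * p + r)
      = (\<Sum>b<N * q. f (i + b div q) $$ (r, b mod q) * x b)"
    using ir r by (simp add: ap_def block_hankel_def)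
  also have "\<dots> = (\<Sum>j<N. \<Sum>b\<in>{j * q..<j * q + q}. f (i + b div q) $$ (r, b mod q) * x b)"
    by (rule sum.nat_group[symmetric])
  also have "\<dots> = (\<Sum>j<N. \<Sum>c<q. f (i + j) $$ (r, c) * x (j * q + c))"
  proof (rule sum.cong[OF refl])
    fix j
    have "(\<Sum>b\<in>{j * q..<j * q + q}. f (i + b div q) $$ (r, b mod q) * x b)
        = (\<Sum>c\<in>{0..<q}. f (i + (c + j * q) div q) $$ (r, (c + j * q) mod q) * x (c + j * q))"
      using sum.shift_bounds_nat_ivl[of "\<lambda>b. f (i + b div q) $$ (r, b mod q) * x b" 0 "j * q" q]
      by (simp add: add.commute)
    also have "\<dots> = (\<Sum>c<q. f (i + j) $$ (r, c) * x (j * q + c))"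
      unfolding atLeast0LessThan by (rule sum.cong) (auto simp: add.commute)
    finally show "(\<Sum>b\<in>{j * q..<j * q + q}. f (i + b div q) $$ (r, b mod q) * x b)
        = (\<Sum>c<q. f (i + j) $$ (r, c) * x (j * q + c))" .
  qed
  finally show ?thesis using r by (simp add: ap_def d)
qed

text \<open>The input blocks enter in reversed order. This reversal is what makes the two systems behind
\<open>Y\<^sub>k\<close> and \<open>Z\<^sub>k\<close> run in opposite directions.\<close>
lemma ap_anti_triangular:
  assumes c: "\<And>s. c s \<in> carrier_mat p q" and i: "i < N" and r: "r < p"
  shows "ap (block_hankel p q N (anti_triangular p q N c)) x (i * p + r)
    = (\<Sum>j\<le>i. ap (c (i - j)) (\<lambda>l. x ((N - Suc j) * q + l)) r)"
proof -
  let ?a = "anti_triangular p q N c"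
  have "ap (block_hankel p q N ?a) x (i * p + r)
      = (\<Sum>j<N. ap (?a (i + j)) (\<lambda>l. x (j * q + l)) r)"
    using c i r by (intro ap_block_hankel) (auto simp: anti_triangular_def)
  also have "\<dots> = (\<Sum>j<N. ap (?a (i + (N - Suc j))) (\<lambda>l. x ((N - Suc j) * q + l)) r)"
    by (rule sum.nat_diff_reindex[symmetric])
  also have "\<dots> = (\<Sum>j\<le>i. ap (?a (i + (N - Suc j))) (\<lambda>l. x ((N - Suc j) * q + l)) r)"
    using i by (intro sum.mono_neutral_right) (auto simp: anti_triangular_def)
  also have "\<dots> = (\<Sum>j\<le>i. ap (c (i - j)) (\<lambda>l. x ((N - Suc j) * q + l)) r)"
  proof (rule sum.cong[OF refl])
    fix j assume "j \<in> {..i}"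
    then have "\<not> i + (N - Suc j) + 1 < N" "i + (N - Suc j) + 1 - N = i - j" using i by auto
    then show "ap (?a (i + (N - Suc j))) (\<lambda>l. x ((N - Suc j) * q + l)) r
        = ap (c (i - j)) (\<lambda>l. x ((N - Suc j) * q + l)) r"
      by (simp add: anti_triangular_def)
  qed
  finally show ?thesis .
qed

section \<open>The doubling matrices as input-output maps\<close>

text \<open>The convolution kernel of \<open>Y\<^sub>k\<close>. These are the Markov parameters (impulse response) of the
two-point scheme
\<open>\<xi>\<^sub>i\<^sub>+\<^sub>1 - \<xi>\<^sub>i + M (a \<xi>\<^sub>i\<^sub>+\<^sub>1 + b \<xi>\<^sub>i) = K h\<^sub>i\<close> with output \<open>G\<^sup>T (a \<xi>\<^sub>i\<^sub>+\<^sub>1 + b \<xi>\<^sub>i)\<close>.\<close>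
definition markov :: "real \<Rightarrow> real \<Rightarrow> real mat \<Rightarrow> real mat \<Rightarrow> real mat \<Rightarrow> nat \<Rightarrow> real mat" where
  "markov a b M G K s = (case s of
     0 \<Rightarrow> a \<cdot>\<^sub>m (transpose_mat G * inv_mat (shift_mat M a) * K)
   | Suc s \<Rightarrow> (a + b) \<cdot>\<^sub>m (transpose_mat G * inv_mat (shift_mat M a) *
       iter_mat (trans_mat M b a) (inv_mat (shift_mat M a) * K) s))"

lemma shift_mat_carrier [simp]: "M \<in> carrier_mat n n \<Longrightarrow> shift_mat M t \<in> carrier_mat n n"
  by (simp add: shift_mat_def)

lemma shift_mat_dim [simp]:
  "dim_row (shift_mat M t) = dim_row M" "dim_col (shift_mat M t) = dim_row M"
  by (simp_all add: shift_mat_def)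

text \<open>\<open>Z\<^sub>k\<close> is \<open>Y\<^sub>k\<close> for the data with the two diagonal blocks, the two parameters and the factors
interchanged, so that only \<open>Y\<^sub>k\<close> has to be analysed.\<close>
lemma Z_mat_eq_Y_mat: "Z_mat a b A Bl Cr k = Y_mat b a A Cr Bl k"
  by (induction k)
    (simp_all add: S_mat_def T_mat_def U_seq_def V_seq_def W_seq_def Q_seq_def add.commute Let_def)

locale realization =
  fixes a b :: real and M G K :: "real mat" and n p q :: nat
  assumes M: "M \<in> carrier_mat n n" and G: "G \<in> carrier_mat n p" and K: "K \<in> carrier_mat n q"
    and a0: "0 \<le> a" and b0: "0 \<le> b"
    and shift_Z: "Z_matrix (shift_mat M a)" and shift_ville: "ville (shift_mat M a)"
    and shift_nonneg: "nonneg_mat (shift_mat M (- b))"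
    and G0: "nonneg_mat G" and K0: "nonneg_mat K"
begin

abbreviation "R \<equiv> inv_mat (shift_mat M a)"

abbreviation "E \<equiv> trans_mat M b a"

lemma R: "R \<in> carrier_mat n n" "shift_mat M a * R = 1\<^sub>m n" "R * shift_mat M a = 1\<^sub>m n"
  "nonneg_mat R"
  using Z_matrix_ville_inverse[OF shift_mat_carrier[OF M] shift_Z shift_ville] by auto

lemma E: "E \<in> carrier_mat n n" "nonneg_mat E"
  using R M shift_nonneg by (auto simp: trans_mat_def intro!: nonneg_mult)

lemma iter: "iter_mat E (R * K) s \<in> carrier_mat n q" "nonneg_mat (iter_mat E (R * K) s)"
proof -
  show c: "iter_mat E (R * K) s \<in> carrier_mat n q" for s
    using E R K by (intro iter_mat_carrier) auto
  show "nonneg_mat (iter_mat E (R * K) s)"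
  proof (induction s)
    case 0
    show ?case using R K K0 by (auto intro!: nonneg_mult)
  next
    case (Suc s)
    then show ?case using E c[of s] by (auto intro!: nonneg_mult)
  qed
qed

lemma markov_carrier: "markov a b M G K s \<in> carrier_mat p q"
proof -
  have "transpose_mat G * R * X \<in> carrier_mat p q" if "X \<in> carrier_mat n q" for X
    using G R that by auto
  then show ?thesis using K iter(1) by (simp add: markov_def split: nat.split)
qed

lemma markov_nonneg: "nonneg_mat (markov a b M G K s)"
proof -
  have "nonneg_mat (transpose_mat G * R * X)" if "X \<in> carrier_mat n q" "nonneg_mat X" for X
    using G G0 R that by (auto intro!: nonneg_mult nonneg_transpose)
  then show ?thesis
    using K K0 iter a0 b0 by (simp add: markov_def nonneg_smult split: nat.split)
qed

lemma T_mat_block_hankel: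
  "(a + b) \<cdot>\<^sub>m T_mat a b M G K k = block_hankel p q (2 ^ k) (\<lambda>s. markov a b M G K (Suc s))"
proof -
  let ?Q = "transpose_mat R * G"
  have Q: "?Q \<in> carrier_mat n p" "transpose_mat ?Q = transpose_mat G * R"
    using R G by (auto simp: transpose_mult[where nr = n and n = n and nc = p])
  have c: "transpose_mat G * R * iter_mat E (R * K) s \<in> carrier_mat p q" for s
    using G R iter(1)[of s] by auto
  have "T_mat a b M G K k
      = block_hankel p q (2 ^ k) (\<lambda>s. transpose_mat G * R * iter_mat E (R * K) s)"
    unfolding T_mat_def
  proof (rule block_row_gram[where n = n])
    show "Q_seq a b M G i \<in> carrier_mat n p" for i
      using E Q by (auto simp: Q_seq_def intro!: iter_mat_carrier)
    show "W_seq a b M K i \<in> carrier_mat n q" for i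
      using iter(1) by (simp add: W_seq_def)
    show "transpose_mat (Q_seq a b M G i) * W_seq a b M K j
        = transpose_mat G * R * iter_mat E (R * K) (i + j)" for i j
      using transpose_iter_mult[OF E(1) Q(1), of "R * K" q i j] R K
      by (simp add: Q_seq_def W_seq_def Q(2))
  qed
  then show ?thesis using c by (simp add: block_hankel_smult markov_def)
qed

lemma Y_mat_block_hankel:
  "Y_mat a b M G K k = block_hankel p q (2 ^ k) (anti_triangular p q (2 ^ k) (markov a b M G K))"
proof (induction k)
  case 0
  have "markov a b M G K 0 = block_hankel p q 1 (anti_triangular p q 1 (markov a b M G K))"
    using markov_carrier[of 0]
    by (intro eq_matI) (auto simp: block_hankel_def anti_triangular_def)
  moreover have "markov a b M G K 0 = Y_mat a b M G K 0" by (simp add: markov_def)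
  ultimately show ?case by simp
next
  case (Suc k)
  have "0 < (2 :: nat) ^ k" by simp
  from anti_triangular_double[OF this, of p q "markov a b M G K"] show ?case
    by (simp add: Let_def Suc.IH T_mat_block_hankel carrier_matD[OF block_hankel_carrier])
qed

lemma Y_mat_carrier: "Y_mat a b M G K k \<in> carrier_mat (2 ^ k * p) (2 ^ k * q)"
  by (simp add: Y_mat_block_hankel)

lemma Y_mat_nonneg: "nonneg_mat (Y_mat a b M G K k)"
proof -
  have "0 \<le> anti_triangular p q N (markov a b M G K) s $$ (i, j)" if "i < p" "j < q" for N s i j
    using markov_nonneg[of "s + 1 - N"] markov_carrier[of "s + 1 - N"] that
    by (auto simp: anti_triangular_def nonneg_mat_def)
  then show ?thesis
    using div_mod_block by (auto simp: Y_mat_block_hankel block_hankel_def nonneg_mat_def)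
qed

text \<open>Applying \<open>Y\<^sub>k\<close> amounts to \<open>2\<^sup>k\<close> steps of the two-point scheme, started at 0 and driven by the input
blocks in reversed order. The formulation by a difference equation contains neither inverses nor
powers, so that the steps can be summed.\<close>
lemma Y_mat_state:
  assumes x: "\<And>j. j < 2 ^ k * q \<Longrightarrow> 0 \<le> x j"
  obtains \<xi> where "\<xi> 0 = (\<lambda>_. 0)" and "\<And>i r. i \<le> 2 ^ k \<Longrightarrow> 0 \<le> \<xi> i r"
    and "\<And>i r. i < 2 ^ k \<Longrightarrow> r < n \<Longrightarrow>
      \<xi> (Suc i) r - \<xi> i r + ap M (\<lambda>l. a * \<xi> (Suc i) l + b * \<xi> i l) r
        = ap K (\<lambda>l. x ((2 ^ k - Suc i) * q + l)) r"
    and "\<And>i r. i < 2 ^ k \<Longrightarrow> r < p \<Longrightarrow>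
      ap (Y_mat a b M G K k) x (i * p + r)
        = ap (transpose_mat G) (\<lambda>l. a * \<xi> (Suc i) l + b * \<xi> i l) r"
proof -
  let ?N = "2 ^ k :: nat"
  define h where "h i = (\<lambda>l. x ((?N - Suc i) * q + l))" for i
  \<comment> \<open>Variation of constants for \<open>\<xi> (Suc i) = E \<xi> i + R K h i\<close>.\<close>
  define \<xi> where "\<xi> i r = (\<Sum>j<i. ap (iter_mat E (R * K) (i - Suc j)) (h j) r)" for i r
  define y where "y i = (\<lambda>r. ap (shift_mat M (- b)) (\<xi> i) r + ap K (h i) r)" for i
  have h0: "0 \<le> h i l" if "i < ?N" "l < q" for i l
  proof -
    have "Suc (?N - Suc i) * q \<le> ?N * q" using that by (intro mult_le_mono1) auto
    then have "(?N - Suc i) * q + l < ?N * q" using that(2) by simp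
    then show ?thesis unfolding h_def by (rule x)
  qed
  have aR: "ap (shift_mat M a) (ap R f) r = f r" if "r < n" for f r
  proof -
    have "ap (shift_mat M a) (ap R f) = ap (1\<^sub>m n) f"
      using R M by (subst ap_mult[symmetric]) auto
    then show ?thesis using that by (simp add: ap_one)
  qed
  have Ra: "ap R (ap (shift_mat M a) f) r = f r" if "r < n" for f r
  proof -
    have "ap R (ap (shift_mat M a) f) = ap (1\<^sub>m n) f"
      using R M by (subst ap_mult[symmetric]) auto
    then show ?thesis using that by (simp add: ap_one)
  qed
  have ESuc: "ap E f = ap R (ap (shift_mat M (- b)) f)" for f
    unfolding trans_mat_def using R M by (subst ap_mult) auto
  have step: "\<xi> (Suc i) = ap R (y i)" for i
  proof
    fix r
    have "\<xi> (Suc i) r = (\<Sum>j<i. ap (iter_mat E (R * K) (Suc (i - Suc j))) (h j) r) + ap (R * K) (h i) r"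
      by (simp add: \<xi>_def Suc_diff_Suc)
    also have "(\<Sum>j<i. ap (iter_mat E (R * K) (Suc (i - Suc j))) (h j) r)
        = (\<Sum>j<i. ap E (ap (iter_mat E (R * K) (i - Suc j)) (h j)) r)"
      by (simp add: ap_mult carrier_matD[OF E(1)] carrier_matD[OF iter(1)])
    also have "\<dots> = ap E (\<xi> i) r" unfolding \<xi>_def by (rule ap_sum[symmetric])
    also have "ap (R * K) (h i) = ap R (ap K (h i))" using R K by (subst ap_mult) auto
    finally show "\<xi> (Suc i) r = ap R (y i) r" by (simp add: ESuc y_def ap_add)
  qed
  show ?thesis
  proof (rule that)
    show "\<xi> 0 = (\<lambda>_. 0)" by (simp add: \<xi>_def fun_eq_iff)
    show "0 \<le> \<xi> i r" if "i \<le> ?N" for i r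
      unfolding \<xi>_def
    proof (rule sum_nonneg)
      fix j assume "j \<in> {..<i}"
      then have "j < ?N" using that by simp
      then show "0 \<le> ap (iter_mat E (R * K) (i - Suc j)) (h j) r"
        using iter(2) h0 by (intro ap_nonneg) (auto simp: carrier_matD[OF iter(1)])
    qed
    show "\<xi> (Suc i) r - \<xi> i r + ap M (\<lambda>l. a * \<xi> (Suc i) l + b * \<xi> i l) r
        = ap K (\<lambda>l. x ((?N - Suc i) * q + l)) r" if "r < n" for i r
    proof -
      have "ap (shift_mat M a) (\<xi> (Suc i)) r = y i r"
        using aR[OF that, of "y i"] by (simp add: step)
      then have "a * ap M (\<xi> (Suc i)) r + \<xi> (Suc i) r
          = - b * ap M (\<xi> i) r + \<xi> i r + ap K (h i) r"
        by (simp add: y_def ap_shift[OF M that])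
      then show ?thesis by (simp add: ap_add ap_scale h_def)
    qed
    show "ap (Y_mat a b M G K k) x (i * p + r)
        = ap (transpose_mat G) (\<lambda>l. a * \<xi> (Suc i) l + b * \<xi> i l) r"
      if i: "i < ?N" and r: "r < p" for i r
    proof -
      have GR: "ap (transpose_mat G * R * X) f = ap (transpose_mat G) (ap R (ap X f))"
        if "dim_row X = n" for X f
        using G R that by (simp add: ap_mult)
      have "ap (Y_mat a b M G K k) x (i * p + r) = (\<Sum>j\<le>i. ap (markov a b M G K (i - j)) (h j) r)"
        unfolding Y_mat_block_hankel h_def by (rule ap_anti_triangular[OF markov_carrier i r])
      also have "\<dots> = (\<Sum>j<i. ap (markov a b M G K (Suc (i - Suc j))) (h j) r)
          + ap (markov a b M G K 0) (h i) r"
        by (simp add: lessThan_Suc_atMost[symmetric] Suc_diff_Suc)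
      also have "ap (markov a b M G K 0) (h i) r = a * ap (transpose_mat G) (ap R (ap K (h i))) r"
        using K by (simp add: markov_def ap_smult GR)
      also have "(\<Sum>j<i. ap (markov a b M G K (Suc (i - Suc j))) (h j) r)
          = (a + b) * (\<Sum>j<i. ap (transpose_mat G * R) (ap (iter_mat E (R * K) (i - Suc j)) (h j)) r)"
        using R
        by (simp add: markov_def ap_smult ap_mult sum_distrib_left carrier_matD[OF iter(1)])
      also have "(\<Sum>j<i. ap (transpose_mat G * R) (ap (iter_mat E (R * K) (i - Suc j)) (h j)) r)
          = ap (transpose_mat G * R) (\<xi> i) r"
        unfolding \<xi>_def by (rule ap_sum[symmetric])
      also have "ap (transpose_mat G * R) (\<xi> i) = ap (transpose_mat G) (ap R (\<xi> i))"
        using G R by (simp add: ap_mult)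
      also have "(a + b) * ap (transpose_mat G) (ap R (\<xi> i)) r
            + a * ap (transpose_mat G) (ap R (ap K (h i))) r
          = ap (transpose_mat G) (\<lambda>l. (a + b) * ap R (\<xi> i) l + a * ap R (ap K (h i)) l) r"
        by (simp add: ap_add ap_scale)
      also have "\<dots> = ap (transpose_mat G) (\<lambda>l. a * \<xi> (Suc i) l + b * \<xi> i l) r"
      proof (rule fun_cong[OF ap_cong])
        fix l assume "l < dim_col (transpose_mat G)"
        then have l: "l < n" using G by simp
        have "a * \<xi> (Suc i) l + b * \<xi> i l
            = a * ap R (y i) l + b * ap R (ap (shift_mat M a) (\<xi> i)) l"
          by (simp add: step Ra[OF l])
        also have "\<dots> = ap R (\<lambda>s. a * y i s + b * ap (shift_mat M a) (\<xi> i) s) l"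
          by (simp add: ap_add ap_scale)
        also have "\<dots> = ap R (\<lambda>s. (a + b) * \<xi> i s + a * ap K (h i) s) l"
        proof (rule fun_cong[OF ap_cong])
          fix s assume "s < dim_col R"
          then have s: "s < n" using R by simp
          show "a * y i s + b * ap (shift_mat M a) (\<xi> i) s = (a + b) * \<xi> i s + a * ap K (h i) s"
            by (simp add: y_def ap_shift[OF M s] algebra_simps)
        qed
        also have "\<dots> = (a + b) * ap R (\<xi> i) l + a * ap R (ap K (h i)) l"
          by (simp only: ap_add ap_scale)
        finally show "(a + b) * ap R (\<xi> i) l + a * ap R (ap K (h i)) l
            = a * \<xi> (Suc i) l + b * \<xi> i l" ..
      qed
      finally show ?thesis .
    qed
  qed
qed

end

section \<open>Two marches in opposite directions\<close>

definition stack :: "nat \<Rightarrow> (nat \<Rightarrow> real) \<Rightarrow> (nat \<Rightarrow> real) \<Rightarrow> nat \<Rightarrow> real" where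
  "stack n u w j = (if j < n then u j else w (j - n))"

lemma sum_lessThan_add_split:
  fixes f :: "nat \<Rightarrow> real"
  shows "(\<Sum>j<n + m. f j) = (\<Sum>j<n. f j) + (\<Sum>j<m. f (n + j))"
  by (induction m) (simp_all add: add.assoc)

lemma ap_block:
  assumes "A \<in> carrier_mat m m" "D \<in> carrier_mat n n" "B \<in> carrier_mat m n" "C \<in> carrier_mat n m"
  shows "i < n \<Longrightarrow> ap (four_block_mat D (- C) (- B) A) (stack n u w) i = ap D u i - ap C w i"
    and "i < m \<Longrightarrow> ap (four_block_mat D (- C) (- B) A) (stack n u w) (n + i) = ap A w i - ap B u i"
  using assms
  by (simp_all add: ap_def stack_def sum_lessThan_add_split sum_negf)

locale block_M =
  fixes A B C D :: "real mat" and m n :: nat and W :: "real mat"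
  assumes A: "A \<in> carrier_mat m m" and D: "D \<in> carrier_mat n n"
    and B: "B \<in> carrier_mat m n" and C: "C \<in> carrier_mat n m"
    and B0: "nonneg_mat B" and C0: "nonneg_mat C"
    and m0: "0 < m" and n0: "0 < n"
  defines "W \<equiv> four_block_mat D (- C) (- B) A"
  assumes M: "M_matrix W"
    and alternative: "nonsingular_M_matrix W \<or> irreducible_mat W"
begin

lemma W: "W \<in> carrier_mat (n + m) (n + m)"
  using A D by (simp add: W_def)

lemma W_Z: "Z_matrix W"
  by (rule M_matrix_Z_matrix[OF M W])

lemmas ap_W = ap_block[OF A D B C, folded W_def]

lemma ap_W_cases:
  assumes "i < n + m"
  obtains "i < n" "ap W (stack n u w) i = ap D u i - ap C w i" "stack n u w i = u i"
  | r where "i = n + r" "r < m" "ap W (stack n u w) i = ap A w r - ap B u r" "stack n u w i = w r"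
proof (cases "i < n")
  case True
  then show ?thesis using that(1) ap_W(1)[OF True] by (simp add: stack_def)
next
  case False
  then obtain r where r: "i = n + r" by (metis le_add_diff_inverse not_less)
  then have "r < m" using assms by simp
  then show ?thesis using that(2)[OF r] ap_W(2) r by (simp add: stack_def)
qed

text \<open>Vectors supported in one block suffice to test a diagonal block, since the off-diagonal blocks of \<open>W\<close>
are nonpositive.\<close>
lemma diagonal_block_ville:
  assumes t: "0 \<le> t"
  shows "ville (shift_mat D t)" and "ville (shift_mat A t)"
proof -
  have v: "ville (shift_mat W t)" by (rule M_matrix_shift_ville[OF M W t])
  have main: "(\<forall>r<n. u r = 0) \<and> (\<forall>r<m. w r = 0)"
    if nn: "\<And>r. r < n \<Longrightarrow> 0 \<le> u r" "\<And>r. r < m \<Longrightarrow> 0 \<le> w r"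
      and le: "\<And>r. r < n \<Longrightarrow> t * (ap D u r - ap C w r) + u r \<le> 0"
        "\<And>r. r < m \<Longrightarrow> t * (ap A w r - ap B u r) + w r \<le> 0" for u w
  proof -
    have z: "stack n u w i = 0" if "i < n + m" for i
    proof (rule villeD[OF v])
      show "i < dim_row (shift_mat W t)" using that W by simp
      fix j assume "j < dim_row (shift_mat W t)"
      then have j: "j < n + m" using W by simp
      show "0 \<le> stack n u w j" using nn j by (auto simp: stack_def)
      show "ap (shift_mat W t) (stack n u w) j \<le> 0"
        unfolding ap_shift[OF W j] by (rule ap_W_cases[OF j, of u w]) (use le in auto)
    qed
    have "u r = 0" if "r < n" for r using z[of r] that by (simp add: stack_def)
    moreover have "w r = 0" if "r < m" for r using z[of "n + r"] that by (simp add: stack_def)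
    ultimately show ?thesis by blast
  qed
  show "ville (shift_mat D t)"
    unfolding ville_def
  proof (intro allI impI)
    fix u i
    assume u: "\<forall>i<dim_row (shift_mat D t). 0 \<le> u i"
      "\<forall>i<dim_row (shift_mat D t). ap (shift_mat D t) u i \<le> 0" and i: "i < dim_row (shift_mat D t)"
    have "0 \<le> ap B u r" for r using u(1) B D by (intro ap_nonneg[OF B0]) auto
    then show "u i = 0"
      using main[of u "\<lambda>_. 0"] u i D t by (simp add: ap_shift[OF D] mult_nonneg_nonpos)
  qed
  show "ville (shift_mat A t)"
    unfolding ville_def
  proof (intro allI impI)
    fix w i
    assume w: "\<forall>i<dim_row (shift_mat A t). 0 \<le> w i"
      "\<forall>i<dim_row (shift_mat A t). ap (shift_mat A t) w i \<le> 0" and i: "i < dim_row (shift_mat A t)"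
    have "0 \<le> ap C w r" for r using w(1) C A by (intro ap_nonneg[OF C0]) auto
    then show "w i = 0"
      using main[of "\<lambda>_. 0" w] w i A t by (simp add: ap_shift[OF A] mult_nonneg_nonpos)
  qed
qed

lemma diagonal_block_Z: "Z_matrix D" "Z_matrix A"
proof -
  show "Z_matrix D"
    unfolding Z_matrix_def
  proof (intro allI impI)
    fix i j assume "i < dim_row D" "j < dim_row D" "i \<noteq> j"
    then show "D $$ (i, j) \<le> 0"
      using W_Z[unfolded Z_matrix_def, rule_format, of i j] A D by (simp add: W_def)
  qed
  show "Z_matrix A"
    unfolding Z_matrix_def
  proof (intro allI impI)
    fix i j assume "i < dim_row A" "j < dim_row A" "i \<noteq> j"
    then show "A $$ (i, j) \<le> 0"
      using W_Z[unfolded Z_matrix_def, rule_format, of "n + i" "n + j"] A D by (simp add: W_def)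
  qed
qed

lemma irreducible_B_nonzero:
  assumes "irreducible_mat W"
  shows "\<exists>i<m. \<exists>j<n. B $$ (i, j) \<noteq> 0"
proof (rule ccontr)
  assume "\<not> ?thesis"
  then have "\<forall>i\<in>{n..<n + m}. \<forall>j\<in>{..<dim_row W} - {n..<n + m}. W $$ (i, j) = 0"
    using A B D W by (auto simp: W_def)
  moreover have "{n..<n + m} \<subset> {..<dim_row W}" using n0 W by (auto simp: psubset_eq set_eq_iff)
  ultimately have "reducible_mat W"
    using m0 unfolding reducible_mat_def by (intro exI[of _ "{n..<n + m}"]) auto
  with assms show False by (simp add: irreducible_mat_def)
qed

text \<open>For \<open>\<alpha> > 0\<close> the equations say that \<open>W (u, w) = (- u, w) / \<alpha>\<close>, so \<open>W (u, w)\<close> vanishes where \<open>(u, w)\<close> does, and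
irreducibility leaves only the cases \<open>(u, w) = 0\<close> and \<open>(u, w) > 0\<close>. In the latter case
\<open>0 \<le> (I - \<alpha> A) w = - \<alpha> B u\<close> would force \<open>B = 0\<close>, and \<open>W\<close> would be reducible.\<close>
lemma irreducible_step_zero:
  assumes irr: "irreducible_mat W"
    and \<alpha>: "0 \<le> \<alpha>" and A0: "nonneg_mat (shift_mat A (- \<alpha>))"
    and u0: "\<And>r. r < n \<Longrightarrow> 0 \<le> u r" and w0: "\<And>r. r < m \<Longrightarrow> 0 \<le> w r"
    and u: "\<And>r. r < n \<Longrightarrow> \<alpha> * (ap D u r - ap C w r) = - u r"
    and w: "\<And>r. r < m \<Longrightarrow> \<alpha> * (ap A w r - ap B u r) = w r"
  shows "(\<forall>r<n. u r = 0) \<and> (\<forall>r<m. w r = 0)"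
proof (cases "\<alpha> = 0")
  case True
  then show ?thesis using u w by fastforce
next
  case False
  have "(\<forall>i<n + m. stack n u w i = 0) \<or> (\<forall>i<n + m. 0 < stack n u w i)"
  proof (rule irreducible_support[OF W W_Z irr])
    show "0 \<le> stack n u w i" if "i < n + m" for i
      using u0 w0 that by (auto simp: stack_def)
    show "0 \<le> ap W (stack n u w) i" if i: "i < n + m" and z: "stack n u w i = 0" for i
      by (rule ap_W_cases[OF i, of u w]) (use u w z False in fastforce)+
  qed
  then show ?thesis
  proof
    assume z: "\<forall>i<n + m. stack n u w i = 0"
    have "u r = 0" if "r < n" for r using z[rule_format, of r] that by (simp add: stack_def)
    moreover have "w r = 0" if "r < m" for r
      using z[rule_format, of "n + r"] that by (simp add: stack_def)
    ultimately show ?thesis by blast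
  next
    assume z: "\<forall>i<n + m. 0 < stack n u w i"
    have upos: "0 < u r" if "r < n" for r using z[rule_format, of r] that by (simp add: stack_def)
    obtain i j where ij: "i < m" "j < n" "B $$ (i, j) \<noteq> 0" using irreducible_B_nonzero[OF irr] by blast
    have "0 \<le> ap (shift_mat A (- \<alpha>)) w i" using A w0 by (intro ap_nonneg[OF A0]) auto
    also have "\<dots> = - (\<alpha> * ap B u i)" using w[OF ij(1)] by (simp add: ap_shift[OF A ij(1)] algebra_simps)
    finally have "ap B u i \<le> 0" using \<alpha> False by (simp add: mult_le_0_iff)
    moreover have "0 < ap B u i"
    proof -
      have Bnn: "0 \<le> B $$ (i, l)" if "l < n" for l
        using B0 B ij that by (auto simp: nonneg_mat_def)
      have "0 < (\<Sum>l<n. B $$ (i, l) * u l)"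
      proof (rule sum_pos2[of _ j])
        show "0 < B $$ (i, j) * u j" using Bnn[of j] upos[of j] ij by (simp add: less_le)
        show "0 \<le> B $$ (i, l) * u l" if "l \<in> {..<n}" for l
          using Bnn[of l] upos[of l] that by (simp add: less_imp_le)
      qed (use ij in auto)
      then show ?thesis using B ij by (simp add: ap_def)
    qed
    ultimately show ?thesis by simp
  qed
qed

text \<open>The heart of the proof. The index \<open>N - Suc i\<close> couples a march \<open>\<xi>\<close> with a march \<open>\<eta>\<close> that runs backwards
relative to it. Summed over all steps, the increments telescope and
\<open>W (\<Sum> a\<^sub>i, \<Sum> b\<^sub>i) \<le> - (\<xi>\<^sub>N, \<eta>\<^sub>N) \<le> 0\<close>. If \<open>W\<close> is nonsingular, the nonnegative sums vanish.
If \<open>W\<close> is irreducible, both final states vanish and all inequalities are equations. The final state of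
\<open>\<eta>\<close> sits at the start of \<open>\<xi>\<close>, so both states are zero there, and \<open>irreducible_step_zero\<close>
propagates this step by step along the march of \<open>\<xi>\<close>.\<close>
lemma opposite_marches_vanish:
  fixes \<alpha> \<beta> :: real and \<xi> \<eta> :: "nat \<Rightarrow> nat \<Rightarrow> real" and N :: nat
  defines "a \<equiv> \<lambda>i r. \<alpha> * \<xi> (Suc i) r + \<beta> * \<xi> i r"
    and "b \<equiv> \<lambda>i r. \<beta> * \<eta> (Suc i) r + \<alpha> * \<eta> i r"
  assumes \<alpha>: "0 \<le> \<alpha>" and \<beta>: "0 \<le> \<beta>" and A0: "nonneg_mat (shift_mat A (- \<alpha>))"
    and start: "\<xi> 0 = (\<lambda>_. 0)" "\<eta> 0 = (\<lambda>_. 0)"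
    and nonneg: "\<And>i r. i \<le> N \<Longrightarrow> 0 \<le> \<xi> i r" "\<And>i r. i \<le> N \<Longrightarrow> 0 \<le> \<eta> i r"
    and \<xi>: "\<And>i r. i < N \<Longrightarrow> r < n \<Longrightarrow>
      \<xi> (Suc i) r - \<xi> i r + ap D (a i) r = ap C (b (N - Suc i)) r"
    and \<eta>: "\<And>i r. i < N \<Longrightarrow> r < m \<Longrightarrow>
      \<eta> (Suc i) r - \<eta> i r + ap A (b i) r \<le> ap B (a (N - Suc i)) r"
    and i: "i < N" and r: "r < n"
  shows "a i r = 0"
proof -
  have a0: "0 \<le> a j s" if "j < N" for j s
    using nonneg(1)[of j s] nonneg(1)[of "Suc j" s] that \<alpha> \<beta> by (simp add: a_def)
  have b0: "0 \<le> b j s" if "j < N" for j s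
    using nonneg(2)[of j s] nonneg(2)[of "Suc j" s] that \<alpha> \<beta> by (simp add: b_def)
  define sa where "sa s = (\<Sum>j<N. a j s)" for s
  define sb where "sb s = (\<Sum>j<N. b j s)" for s
  define slack where
    "slack j s = ap B (a (N - Suc j)) s - (\<eta> (Suc j) s - \<eta> j s + ap A (b j) s)" for j s
  have sa0: "0 \<le> sa s" and sb0: "0 \<le> sb s" for s
    unfolding sa_def sb_def using a0 b0 by (auto intro!: sum_nonneg)
  have ap_sa: "ap X sa s = (\<Sum>j<N. ap X (a j) s)" and ap_sb: "ap X sb s = (\<Sum>j<N. ap X (b j) s)"
    for X s
    unfolding sa_def sb_def by (rule ap_sum)+
  have ap_sa': "(\<Sum>j<N. ap X (a (N - Suc j)) s) = ap X sa s"
    and ap_sb': "(\<Sum>j<N. ap X (b (N - Suc j)) s) = ap X sb s" for X s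
    unfolding ap_sa ap_sb by (rule sum.nat_diff_reindex)+
  have tele: "(\<Sum>j<N. x (Suc j) s - x j s) = x N s - x 0 s" for x :: "nat \<Rightarrow> nat \<Rightarrow> real" and s
    by (rule sum_lessThan_telescope)
  have D_total: "ap D sa s - ap C sb s = - \<xi> N s" if "s < n" for s
  proof -
    have "(\<Sum>j<N. (\<xi> (Suc j) s - \<xi> j s) + ap D (a j) s) = (\<Sum>j<N. ap C (b (N - Suc j)) s)"
      using \<xi> that by (intro sum.cong) auto
    then show ?thesis
      unfolding sum.distrib tele ap_sb' by (simp add: ap_sa start)
  qed
  have A_total: "ap A sb s - ap B sa s = - \<eta> N s - (\<Sum>j<N. slack j s)" for s
  proof -
    have "(\<Sum>j<N. slack j s) = ap B sa s - (\<eta> N s - \<eta> 0 s + ap A sb s)"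
      unfolding slack_def sum_subtractf[of "\<lambda>j. ap B (a (N - Suc j)) s"] ap_sa' sum.distrib tele
      by (simp add: ap_sb)
    then show ?thesis by (simp add: start)
  qed
  have slack0: "0 \<le> slack j s" if "j < N" "s < m" for j s
    using \<eta>[OF that] by (simp add: slack_def)
  have slack_sum0: "0 \<le> (\<Sum>j<N. slack j s)" if "s < m" for s
    using slack0 that by (auto intro!: sum_nonneg)
  let ?z = "stack n sa sb"
  have z0: "0 \<le> ?z j" for j by (simp add: stack_def sa0 sb0)
  have Wz: "ap W ?z j \<le> 0" if j: "j < n + m" for j
  proof (rule ap_W_cases[OF j, of sa sb])
    assume "j < n" "ap W ?z j = ap D sa j - ap C sb j"
    then show ?thesis using D_total nonneg(1)[of N j] by simp
  next
    fix s assume "s < m" "ap W ?z j = ap A sb s - ap B sa s"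
    then show ?thesis using A_total nonneg(2)[of N s] slack_sum0[of s] by simp
  qed
  show ?thesis
  proof (cases "nonsingular_M_matrix W")
    case True
    have "?z r = 0"
      using villeD[OF nonsingular_M_matrix_ville[OF True W], of ?z r] z0 Wz W r by simp
    then have "(\<Sum>j<N. a j r) = 0" using r by (simp add: stack_def sa_def)
    then show ?thesis using a0 i by (intro sum_nonneg_0[of "{..<N}" "\<lambda>j. a j r"]) auto
  next
    case False
    then have irr: "irreducible_mat W" using alternative by simp
    have null: "ap W ?z j = 0" if "j < n + m" for j
      using irreducible_M_matrix_null[OF W M irr, of ?z] z0 Wz that by blast
    have \<xi>N: "\<xi> N s = 0" if "s < n" for s
      using null[of s] ap_W(1)[OF that, of sa sb] D_total[OF that] that by simp
    have \<eta>N: "\<eta> N s = 0" and slack_zero: "j < N \<Longrightarrow> slack j s = 0" if "s < m" for s j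
    proof -
      have *: "- \<eta> N s - (\<Sum>j<N. slack j s) = 0"
        using null[of "n + s"] ap_W(2)[OF that, of sa sb] A_total[of s] that by simp
      then show "\<eta> N s = 0" using nonneg(2)[of N s] slack_sum0[OF that] by simp
      then have "(\<Sum>j<N. slack j s) = 0" using * by simp
      then show "j < N \<Longrightarrow> slack j s = 0"
        using slack0 that by (intro sum_nonneg_0[of "{..<N}" "\<lambda>j. slack j s"]) auto
    qed
    \<comment> \<open>After \<open>j\<close> steps of \<open>\<xi>\<close> the matching state of \<open>\<eta>\<close> has index \<open>N - j\<close>.\<close>
    have zero: "(\<forall>s<n. \<xi> j s = 0) \<and> (\<forall>s<m. \<eta> (N - j) s = 0)" if "j \<le> N" for j
      using that
    proof (induction j)
      case 0
      then show ?case using \<eta>N by (simp add: start)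
    next
      case (Suc j)
      define l where "l = N - Suc j"
      have l: "Suc l = N - j" "l < N" "N - Suc l = j" "j < N" using Suc.prems by (auto simp: l_def)
      have IH: "\<And>s. s < n \<Longrightarrow> \<xi> j s = 0" "\<And>s. s < m \<Longrightarrow> \<eta> (Suc l) s = 0"
        using Suc l by auto
      have aj: "ap X (a j) = ap X (\<lambda>s. \<alpha> * \<xi> (Suc j) s)" if "dim_col X = n" for X
        using IH(1) that by (intro ap_cong) (simp add: a_def)
      have bl: "ap X (b l) = ap X (\<lambda>s. \<alpha> * \<eta> l s)" if "dim_col X = m" for X
        using IH(2) that by (intro ap_cong) (simp add: b_def)
      have "(\<forall>r<n. \<xi> (Suc j) r = 0) \<and> (\<forall>r<m. \<eta> l r = 0)"
      proof (rule irreducible_step_zero[OF irr \<alpha> A0])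
        show "0 \<le> \<xi> (Suc j) s" for s using nonneg(1) Suc.prems by simp
        show "0 \<le> \<eta> l s" for s using nonneg(2) l by simp
        show "\<alpha> * (ap D (\<xi> (Suc j)) s - ap C (\<eta> l) s) = - \<xi> (Suc j) s" if "s < n" for s
          using \<xi>[of j s] that l(4) IH(1)[OF that] C D
          by (simp add: l_def[symmetric] aj bl ap_scale algebra_simps)
        show "\<alpha> * (ap A (\<eta> l) s - ap B (\<xi> (Suc j)) s) = \<eta> l s" if "s < m" for s
          using slack_zero[OF that l(2)] IH(2)[OF that] A B
          by (simp add: slack_def l(3) aj bl ap_scale algebra_simps)
      qed
      then show ?case by (simp add: l_def)
    qed
    show ?thesis using zero[of i] zero[of "Suc i"] i r by (simp add: a_def)
  qed
qed

end

section \<open>The doubling matrices yield nonsingular M-matrices\<close>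

text \<open>If \<open>x \<le> Z Y x\<close>, then \<open>y = Y x\<close> satisfies \<open>y \<le> Y Z y\<close>; and \<open>Y x = 0\<close> gives \<open>x \<le> 0\<close>.\<close>
lemma ville_one_minus_mult_commute:
  assumes Y: "Y \<in> carrier_mat n l" and Z: "Z \<in> carrier_mat l n"
    and Y0: "nonneg_mat Y" and v: "ville (1\<^sub>m n - Y * Z)"
  shows "ville (1\<^sub>m l - Z * Y)"
  unfolding ville_def
proof (intro allI impI)
  fix x i
  assume "\<forall>i<dim_row (1\<^sub>m l - Z * Y). 0 \<le> x i" "\<forall>i<dim_row (1\<^sub>m l - Z * Y). ap (1\<^sub>m l - Z * Y) x i \<le> 0"
    "i < dim_row (1\<^sub>m l - Z * Y)"
  then have x0: "\<And>i. i < l \<Longrightarrow> 0 \<le> x i" and x: "\<And>i. i < l \<Longrightarrow> x i \<le> ap Z (ap Y x) i" and i: "i < l"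
    using Y Z by (auto simp: ap_minus_mat ap_one ap_mult)
  have "ap Y x j = 0" if "j < n" for j
  proof (rule villeD[OF v])
    fix j assume "j < dim_row (1\<^sub>m n - Y * Z)"
    then have j: "j < n" using Y by simp
    show "0 \<le> ap Y x j" using x0 Y by (intro ap_nonneg[OF Y0]) auto
    have "ap Y x j \<le> ap Y (ap Z (ap Y x)) j" using x Y by (intro ap_mono[OF Y0]) auto
    then show "ap (1\<^sub>m n - Y * Z) (ap Y x) j \<le> 0"
      using Y Z j by (simp add: ap_minus_mat ap_one ap_mult)
  qed (use Y that in auto)
  then have "ap Z (ap Y x) = ap Z (\<lambda>_. 0)" using Z by (intro ap_cong) auto
  then show "x i = 0" using x[OF i] x0[OF i] by simp
qed

lemma Z_matrix_shift:
  "M \<in> carrier_mat n n \<Longrightarrow> Z_matrix M \<Longrightarrow> 0 \<le> t \<Longrightarrow> Z_matrix (shift_mat M t)"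
  by (auto simp: Z_matrix_def shift_mat_def mult_nonneg_nonpos)

text \<open>Only a positive diagonal entry makes the bound on \<open>t\<close> informative; for the others the sign of \<open>t\<close>
is enough.\<close>
lemma nonneg_shift_neg:
  assumes M: "M \<in> carrier_mat n n" and Z: "Z_matrix M" and t: "0 \<le> t"
    and le: "t \<le> Min ((\<lambda>i. inverse (M $$ (i, i))) ` {..<n})"
  shows "nonneg_mat (shift_mat M (- t))"
proof -
  have "t * M $$ (i, i) \<le> 1" if "i < n" for i
  proof (cases "0 < M $$ (i, i)")
    case True
    have "t \<le> inverse (M $$ (i, i))" using le that by (subst (asm) Min_ge_iff) auto
    then show ?thesis using True by (simp add: field_simps)
  next
    case False
    then have "t * M $$ (i, i) \<le> 0" using t by (simp add: mult_nonneg_nonpos)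
    then show ?thesis by simp
  qed
  moreover have "t * M $$ (i, j) \<le> 0" if "i < n" "j < n" "i \<noteq> j" for i j
    using Z M that t by (auto simp: Z_matrix_def mult_nonneg_nonpos)
  ultimately show ?thesis using M by (auto simp: nonneg_mat_def shift_mat_def)
qed

theorem theorem2p2:
  fixes A B C D Bl Br Cl Cr :: "real mat" and \<alpha> \<beta> :: real and m n p q k :: nat
  assumes "0 < m" and "0 < n"
    and "A \<in> carrier_mat m m" and "D \<in> carrier_mat n n"
    and "B \<in> carrier_mat m n" and "C \<in> carrier_mat n m"
    and "nonsingular_M_matrix (four_block_mat D (- C) (- B) A) \<or>
         (irreducible_mat (four_block_mat D (- C) (- B) A) \<and>
          singular_M_matrix (four_block_mat D (- C) (- B) A))"
    and "Bl \<in> carrier_mat m p" and "Br \<in> carrier_mat n p"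
    and "Cl \<in> carrier_mat n q" and "Cr \<in> carrier_mat m q"
    and "0\<^sub>m m p \<le> Bl" and "0\<^sub>m n p \<le> Br" and "0\<^sub>m n q \<le> Cl" and "0\<^sub>m m q \<le> Cr"
    and "full_column_rank Bl" and "full_column_rank Br"
    and "full_column_rank Cl" and "full_column_rank Cr"
    and "B = Bl * transpose_mat Br" and "C = Cl * transpose_mat Cr"
    and "0 \<le> \<alpha>" and "\<alpha> \<le> Min ((\<lambda>i. inverse (A $$ (i, i))) ` {..<m})"
    and "0 \<le> \<beta>" and "\<beta> \<le> Min ((\<lambda>j. inverse (D $$ (j, j))) ` {..<n})"
    and "max \<alpha> \<beta> > 0"
  shows "nonsingular_M_matrix
           (1\<^sub>m (2 ^ k * p) - Y_mat \<alpha> \<beta> D Br Cl k * Z_mat \<alpha> \<beta> A Bl Cr k)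
       \<and> nonsingular_M_matrix
           (1\<^sub>m (2 ^ k * q) - Z_mat \<alpha> \<beta> A Bl Cr k * Y_mat \<alpha> \<beta> D Br Cl k)"
proof -
  note A = assms(3) and D = assms(4) and Bl = assms(8) and Br = assms(9)
    and Cl = assms(10) and Cr = assms(11) and \<alpha> = assms(22) and \<beta> = assms(24)
  have Bl0: "nonneg_mat Bl" and Br0: "nonneg_mat Br" and Cl0: "nonneg_mat Cl" and Cr0: "nonneg_mat Cr"
    using assms(12-15) Bl Br Cl Cr by (simp_all add: nonneg_mat_iff)
  have B0: "nonneg_mat B"
    unfolding assms(20) using Bl0 Br0 Bl Br by (intro nonneg_mult nonneg_transpose) auto
  have C0: "nonneg_mat C"
    unfolding assms(21) using Cl0 Cr0 Cl Cr by (intro nonneg_mult nonneg_transpose) auto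
  interpret block_M A B C D m n "four_block_mat D (- C) (- B) A"
    by unfold_locales
      (use assms(1-7) B0 C0 in \<open>auto simp: nonsingular_M_matrix_def singular_M_matrix_def\<close>)
  have A0: "nonneg_mat (shift_mat A (- \<alpha>))"
    by (rule nonneg_shift_neg[OF A diagonal_block_Z(2) \<alpha> assms(23)])
  have D0: "nonneg_mat (shift_mat D (- \<beta>))"
    by (rule nonneg_shift_neg[OF D diagonal_block_Z(1) \<beta> assms(25)])
  interpret Y: realization \<alpha> \<beta> D Br Cl n p q
    using D Br Cl \<alpha> \<beta> D0 Br0 Cl0 Z_matrix_shift[OF D diagonal_block_Z(1) \<alpha>]
      diagonal_block_ville(1)[OF \<alpha>]
    by unfold_locales simp_all
  interpret Z: realization \<beta> \<alpha> A Cr Bl m q p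
    using A Cr Bl \<alpha> \<beta> A0 Cr0 Bl0 Z_matrix_shift[OF A diagonal_block_Z(2) \<beta>]
      diagonal_block_ville(2)[OF \<beta>]
    by unfold_locales simp_all
  let ?N = "2 ^ k :: nat"
  let ?Y = "Y_mat \<alpha> \<beta> D Br Cl k" and ?Z = "Y_mat \<beta> \<alpha> A Cr Bl k"
  note Yc = Y.Y_mat_carrier[of k] and Zc = Z.Y_mat_carrier[of k]
    and Y0 = Y.Y_mat_nonneg[of k] and Z0 = Z.Y_mat_nonneg[of k]
  have v: "ville (1\<^sub>m (?N * p) - ?Y * ?Z)"
    unfolding ville_def
  proof (intro allI impI)
    fix x c
    let ?P = "1\<^sub>m (?N * p) - ?Y * ?Z"
    assume "\<forall>i<dim_row ?P. 0 \<le> x i" "\<forall>i<dim_row ?P. ap ?P x i \<le> 0" "c < dim_row ?P"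
    then have x0: "\<And>i. i < ?N * p \<Longrightarrow> 0 \<le> x i"
      and x: "\<And>i. i < ?N * p \<Longrightarrow> x i \<le> ap ?Y (ap ?Z x) i" and c: "c < ?N * p"
      using Yc Zc by (auto simp: ap_minus_mat ap_one ap_mult)
    define h where "h = ap ?Z x"
    have h0: "0 \<le> h i" for i
      unfolding h_def using x0 Zc by (intro ap_nonneg[OF Z0]) auto
    \<comment> \<open>Both applications are read as marches: \<open>\<eta>\<close> turns \<open>x\<close> into \<open>h = Z\<^sub>k x\<close>, and \<open>\<xi>\<close> turns
      \<open>h\<close> into \<open>Y\<^sub>k h\<close>. The factorizations of \<open>B\<close> and \<open>C\<close> couple them.\<close>
    obtain \<xi> where \<xi>: "\<xi> 0 = (\<lambda>_. 0)" "\<And>i r. i \<le> ?N \<Longrightarrow> 0 \<le> \<xi> i r"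
      "\<And>i r. i < ?N \<Longrightarrow> r < n \<Longrightarrow>
        \<xi> (Suc i) r - \<xi> i r + ap D (\<lambda>l. \<alpha> * \<xi> (Suc i) l + \<beta> * \<xi> i l) r
          = ap Cl (\<lambda>l. h ((?N - Suc i) * q + l)) r"
      "\<And>i r. i < ?N \<Longrightarrow> r < p \<Longrightarrow>
        ap ?Y h (i * p + r) = ap (transpose_mat Br) (\<lambda>l. \<alpha> * \<xi> (Suc i) l + \<beta> * \<xi> i l) r"
      using Y.Y_mat_state[of k h] h0 by blast
    obtain \<eta> where \<eta>: "\<eta> 0 = (\<lambda>_. 0)" "\<And>i r. i \<le> ?N \<Longrightarrow> 0 \<le> \<eta> i r"
      "\<And>i r. i < ?N \<Longrightarrow> r < m \<Longrightarrow>
        \<eta> (Suc i) r - \<eta> i r + ap A (\<lambda>l. \<beta> * \<eta> (Suc i) l + \<alpha> * \<eta> i l) r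
          = ap Bl (\<lambda>l. x ((?N - Suc i) * p + l)) r"
      "\<And>i r. i < ?N \<Longrightarrow> r < q \<Longrightarrow>
        h (i * q + r) = ap (transpose_mat Cr) (\<lambda>l. \<beta> * \<eta> (Suc i) l + \<alpha> * \<eta> i l) r"
      unfolding h_def using Z.Y_mat_state[of k x] x0 by blast
    let ?a = "\<lambda>i l. \<alpha> * \<xi> (Suc i) l + \<beta> * \<xi> i l" and ?b = "\<lambda>i l. \<beta> * \<eta> (Suc i) l + \<alpha> * \<eta> i l"
    have x_le: "x (i * p + r) \<le> ap (transpose_mat Br) (?a i) r" if "i < ?N" "r < p" for i r
    proof -
      have "i * p + r < ?N * p"
        using mult_le_mono1[of "Suc i" ?N p] that by simp
      from x[OF this] show ?thesis using \<xi>(4)[OF that] by (simp add: h_def)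
    qed
    have a_zero: "?a i r = 0" if "i < ?N" "r < n" for i r
    proof (rule opposite_marches_vanish[where \<alpha> = \<alpha> and \<beta> = \<beta> and \<xi> = \<xi> and \<eta> = \<eta> and N = ?N,
          OF \<alpha> \<beta> A0 \<xi>(1) \<eta>(1) \<xi>(2) \<eta>(2) _ _ that])
      fix i r :: nat assume i: "i < ?N"
      then have j: "?N - Suc i < ?N" by simp
      show "\<xi> (Suc i) r - \<xi> i r + ap D (?a i) r = ap C (?b (?N - Suc i)) r" if "r < n"
      proof -
        have "ap Cl (\<lambda>l. h ((?N - Suc i) * q + l)) = ap Cl (ap (transpose_mat Cr) (?b (?N - Suc i)))"
          using \<eta>(4)[OF j] Cl by (intro ap_cong) auto
        also have "\<dots> = ap C (?b (?N - Suc i))"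
          unfolding assms(21) using Cl Cr by (subst ap_mult) auto
        finally show ?thesis using \<xi>(3)[OF i that] by simp
      qed
      show "\<eta> (Suc i) r - \<eta> i r + ap A (?b i) r \<le> ap B (?a (?N - Suc i)) r" if "r < m"
      proof -
        have "ap Bl (\<lambda>l. x ((?N - Suc i) * p + l)) r
            \<le> ap Bl (ap (transpose_mat Br) (?a (?N - Suc i))) r"
          using x_le[OF j] Bl by (intro ap_mono[OF Bl0]) auto
        also have "\<dots> = ap B (?a (?N - Suc i)) r"
          unfolding assms(20) using Bl Br by (subst ap_mult) auto
        finally show ?thesis using \<eta>(3)[OF i that] by simp
      qed
    qed
    have "c div p * p + c mod p = c" by simp
    then have "x c \<le> ap (transpose_mat Br) (?a (c div p)) (c mod p)"
      using x_le[of "c div p" "c mod p"] div_mod_block[OF c] by simp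
    also have "\<dots> = ap (transpose_mat Br) (\<lambda>_. 0) (c mod p)"
      using a_zero[OF div_mod_block(1)[OF c]] Br by (intro fun_cong[OF ap_cong]) auto
    finally show "x c = 0" using x0[OF c] by simp
  qed
  have "nonsingular_M_matrix (1\<^sub>m (?N * p) - ?Y * ?Z)"
    using Yc Zc by (intro nonsingular_M_matrix_if_ville[OF _ nonneg_mult[OF Y0 Z0] v]) auto
  moreover have "nonsingular_M_matrix (1\<^sub>m (?N * q) - ?Z * ?Y)"
    using Yc Zc
    by (intro nonsingular_M_matrix_if_ville[OF _ nonneg_mult[OF Z0 Y0]
          ville_one_minus_mult_commute[OF Yc Zc Y0 v]]) auto
  ultimately show ?thesis by (simp add: Z_mat_eq_Y_mat)
qed

end
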